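(* Let $N,n\ge1$ be integers, let $\omega=(\omega_1,\dots,\omega_N)\in\mathbb{C}^N$ with $\mathrm{Re}(\omega_i)>0$ for all $i$, and let $z_1,\dots,z_n\in\mathbb{C}$ with $z_j\ne k\cdot\omega$ for all $k\in\mathbb{N}^N$ and all $j$. Then $$ \begin{aligned} D_N(z_1,\dots,z_n;\omega)\prod_{j=1}^{n}\Gamma_N(-z_j;\omega)=\exp\Bigg(&\Big(1-\frac1n\Big)\sum_{j=1}^{n}\sum_{\ell=2}^{N}\frac{(-1)^{N-\ell}H_{\ell-1}}{\ell!\,(N-\ell)!}B_{N,N-\ell}(0;\omega)\,z_j^\ell\\ &-\frac1n\sum_{1\le j_1<j_2\le n}\sum_{\ell=2}^{N}\sum_{r=1}^{\ell-1}\frac{(-1)^{N-\ell}B_{N,N-\ell}(0;\omega)\,z_{j_1}^{r}z_{j_2}^{\ell-r}}{r(\ell-r)(\ell-1)!\,(N-\ell)!}\Bigg). \end{aligned} $$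
   Context: $\mathbb{N}=\{0,1,2,\dots\}$, $k\cdot\omega=\sum_{i=1}^N k_i\omega_i$, and $H_n=\sum_{i=1}^n1/i$. Barnes multiple zeta function: $\zeta_N(s,w;\omega)=\sum_{k\in\mathbb{N}^N}(k\cdot\omega+w)^{-s}$ for $\mathrm{Re}(s)>N$; it continues meromorphically in $s$ to $\mathbb{C}$ with only simple poles, at $s=1,\dots,N$. The Barnes multiple gamma function (normalized by zeta regularization) is $\Gamma_N(w;\omega)=\exp(\partial_s\zeta_N(0,w;\omega))$. These are used for $w\in\mathbb{C}$ with $k\cdot\omega+w\neq0$ for all $k\in\mathbb{N}^N$. $D_N(z_1,\dots,z_n;\omega)$ is the zeta regularized product over $k\in\mathbb{N}^N$ of $\prod_{j=1}^n(k\cdot\omega-z_j)$; that is, $D_N(z_1,\dots,z_n;\omega)=\exp(-\partial_s Z(0))$, where $Z(s)=\sum_{k\in\mathbb{N}^N}\prod_{j=1}^n(k\cdot\omega-z_j)^{-s}$ for $\mathrm{Re}(s)>N/n$, meromorphically continued to a region containing $s=0$, where it is holomorphic. Branch convention: $x^{-s}=e^{-s\log x}$ with the principal logarithm when $\mathrm{Re}(x)>0$; for the finitely many factors $k\cdot\omega-z_j$ (or $k\cdot\omega+w$) with nonpositive real part any branch is allowed (this does not affect the values). The multiple Bernoulli polynomials $B_{N,n}(x;\omega)$ are defined near $t=0$ by $$\frac{t^Ne^{xt}}{(e^{\omega_1t}-1)\cdots(e^{\omega_Nt}-1)}=\sum_{n=0}^\infty\frac{t^n}{n!}B_{N,n}(x;\omega).$$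 *)

theory Defs
  imports "HOL-Complex_Analysis.Complex_Analysis"
begin

text \<open>
  A vector of \<open>N\<close> complex numbers is a function on indices \<open>1, \<dots>, N\<close>; its other values are
  irrelevant.  Multi-indices are extensional functions, so that each point of the lattice
  occurs exactly once in the sums below.
\<close>

definition multi_indices :: "nat \<Rightarrow> (nat \<Rightarrow> nat) set" where
  "multi_indices N = {1..N} \<rightarrow>\<^sub>E UNIV"

definition idot :: "nat \<Rightarrow> (nat \<Rightarrow> nat) \<Rightarrow> (nat \<Rightarrow> complex) \<Rightarrow> complex" where
  "idot N k \<omega> = (\<Sum>i=1..N. of_nat (k i) * \<omega> i)"

text \<open>
  All complex powers use the principal branch \<^term>\<open>Ln\<close>, also for the finitely many bases with
  nonpositive real part.  \<^const>\<open>nicely_meromorphic_on\<close> prescribes the value \<open>0\<close> at poles and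
  the limit at removable singularities; this makes the continuation to the plane unique.
\<close>

definition barnes_zeta :: "nat \<Rightarrow> complex \<Rightarrow> complex \<Rightarrow> (nat \<Rightarrow> complex) \<Rightarrow> complex" where
  "barnes_zeta N s w \<omega> =
     (THE G. G nicely_meromorphic_on UNIV \<and>
        (\<forall>s. Re s > real N \<longrightarrow>
           G s = (\<Sum>\<^sub>\<infinity>k\<in>multi_indices N. (idot N k \<omega> + w) powr (- s)))) s"

definition barnes_Gamma :: "nat \<Rightarrow> complex \<Rightarrow> (nat \<Rightarrow> complex) \<Rightarrow> complex" where
  "barnes_Gamma N w \<omega> = exp (deriv (\<lambda>s. barnes_zeta N s w \<omega>) 0)"

text \<open>
  For the regularized product, the region containing \<open>0\<close> to which the Dirichlet series is
  continued is an open half-plane.  Any two such continuations agree near \<open>0\<close>, so the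
  derivative at \<open>0\<close> does not depend on the choice of \<open>Z\<close>.
\<close>

definition barnes_D :: "nat \<Rightarrow> nat \<Rightarrow> (nat \<Rightarrow> complex) \<Rightarrow> (nat \<Rightarrow> complex) \<Rightarrow> complex" where
  "barnes_D N n z \<omega> = exp (- deriv
     (SOME Z. (\<exists>\<epsilon>>0. Z meromorphic_on {s. Re s > - \<epsilon>}) \<and> Z analytic_on {0} \<and>
        (\<forall>s. Re s > real N / real n \<longrightarrow>
           Z s = (\<Sum>\<^sub>\<infinity>k\<in>multi_indices N. \<Prod>j=1..n. (idot N k \<omega> - z j) powr (- s)))) 0)"

text \<open>
  The quotient of formal power series is the genuine one (not a truncated one) if all
  \<open>\<omega> i\<close> are nonzero, since numerator and denominator then both have order of vanishing \<open>N\<close>;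
  see the lemma below.
\<close>

definition multi_bernoulli :: "nat \<Rightarrow> nat \<Rightarrow> complex \<Rightarrow> (nat \<Rightarrow> complex) \<Rightarrow> complex" where
  "multi_bernoulli N m x \<omega> =
     fact m * fps_nth (fps_X ^ N * fps_exp x / (\<Prod>i=1..N. (fps_exp (\<omega> i) - 1))) m"

lemma multi_bernoulli_generating_function:
  assumes "\<And>i. i \<in> {1..N} \<Longrightarrow> \<omega> i \<noteq> 0"
  shows "eventually (\<lambda>t. (\<lambda>m. t ^ m / fact m * multi_bernoulli N m x \<omega>) sums
           (t ^ N * exp (x * t) / (\<Prod>i=1..N. (exp (\<omega> i * t) - 1)))) (at 0)"
proof -
  define F where "F = fps_X ^ N * fps_exp x"
  define G where "G = (\<Prod>i=1..N. (fps_exp (\<omega> i) - 1))"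
  have nz: "fps_exp (\<omega> i) - 1 \<noteq> 0" and sd: "subdegree (fps_exp (\<omega> i) - 1) = 1"
    if "i \<in> {1..N}" for i
  proof -
    have "fps_nth (fps_exp (\<omega> i) - 1) 1 \<noteq> 0" using assms[OF that] by simp
    then show "fps_exp (\<omega> i) - 1 \<noteq> 0" "subdegree (fps_exp (\<omega> i) - 1) = 1"
      by (auto intro!: subdegreeI)
  qed
  have G0: "G \<noteq> 0" unfolding G_def using nz by auto
  have "subdegree G = (\<Sum>i=1..N. subdegree (fps_exp (\<omega> i) - 1))"
    unfolding G_def using nz by (subst subdegree_prod) auto
  also have "\<dots> = N" using sd by simp
  finally have sG: "subdegree G = N" .
  have sF: "subdegree F = N" unfolding F_def by simp
  have f: "(\<lambda>t. t ^ N * exp (x * t)) has_fps_expansion F"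
    unfolding F_def by (intro fps_expansion_intros)
  have g: "(\<lambda>t. \<Prod>i=1..N. (exp (\<omega> i * t) - 1)) has_fps_expansion G"
    unfolding G_def by (intro fps_expansion_intros)
  have q: "(\<lambda>t. if t = 0 then fps_nth F (subdegree G) / fps_nth G (subdegree G)
      else t ^ N * exp (x * t) / (\<Prod>i=1..N. (exp (\<omega> i * t) - 1))) has_fps_expansion (F / G)"
    by (rule has_fps_expansion_divide[OF f g]) (use G0 sF sG in auto)
  have rad: "fps_conv_radius (F / G) > 0"
    and ev: "eventually (\<lambda>t. eval_fps (F / G) t =
      (if t = 0 then fps_nth F (subdegree G) / fps_nth G (subdegree G)
       else t ^ N * exp (x * t) / (\<Prod>i=1..N. (exp (\<omega> i * t) - 1)))) (nhds 0)"
    using q unfolding has_fps_expansion_def by auto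
  have "eventually (\<lambda>t. t \<in> eball 0 (fps_conv_radius (F / G))) (nhds 0)"
    using rad by (intro eventually_nhds_in_open) (auto simp: zero_ereal_def)
  with ev have "eventually (\<lambda>t. t \<noteq> 0 \<longrightarrow> (\<lambda>m. t ^ m / fact m * multi_bernoulli N m x \<omega>) sums
           (t ^ N * exp (x * t) / (\<Prod>i=1..N. (exp (\<omega> i * t) - 1)))) (nhds 0)"
  proof eventually_elim
    case (elim t)
    have "(\<lambda>m. fps_nth (F / G) m * t ^ m) sums eval_fps (F / G) t"
      using elim(2) by (intro sums_eval_fps) auto
    then show ?case using elim(1)
      by (auto simp: multi_bernoulli_def F_def G_def mult.commute)
  qed
  then show ?thesis by (simp add: eventually_at_filter)
qed

end

(* Write lambda_k = k . omega. Formally, the sum over k of f(lambda_k + w) telescopes once f is written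
   as Delta_1 ... Delta_N F with Delta_i F(x) = F(x + omega_i) - F(x). Since
   1 / prod (e^(omega_i D) - 1) = D^(-N) sum B_{N,n} D^n / n!, a truncation of the right-hand side
   applied to f(x) = x^(-s) gives an explicit F for which f - Delta_1 ... Delta_N F decays as fast as
   desired. Cutting F off at finitely many small k makes the telescoping sum vanish, and this continues
   sum lambda_k^(-s) to the plane; the simple poles s = 1, ..., N come from the denominators
   prod (i - s) in F, and their residues are given by Bernoulli numbers because Delta_1 ... Delta_N
   annihilates polynomials of degree < N.

   For the product, expand prod_j (1 - z_j u)^(-s) = sum_m P_m(s) u^m at u = 1 / lambda_k. Then
   Z(s) = sum_{m <= N} P_m(s) zeta(n s + m) + (a series convergent near s = 0), where P_m(0) = 0 for
   m >= 1. In Z'(0) everything is additive in the z_j except the contribution P_m''(0) / 2 of the pole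
   of zeta at m, which is Res_m / n times the u^m-coefficient of (sum_j log(1 - z_j u))^2 / 2.
   Comparing n with the case n = 1 for each z_j leaves exactly these quadratic terms. *)
theory Submission
  imports Defs
begin

section \<open>Series of holomorphic functions and continuation\<close>

text \<open>Only finitely many points k . omega + w lie outside the right half-plane, inside which x
  powr b * (1 + h / x) powr b is (x + h) powr b for |h| < |x|. So each expansion runs over a tail of
  the lattice with Re(k . omega + w) above a prescribed bound; the finitely many other powers are
  entire in s. The denominators of F are cleared by \<open>pole_poly\<close>: the object that is
  continued is the entire function Y = \<open>pole_poly\<close> * zeta. The decay of f - Delta_1 ...
  Delta_N F is read off in u = 1 / x, where it means vanishing Taylor coefficients; Cauchy's
  inequality, with s in a compact set, makes it locally uniform in s, as holomorphy of the series
  demands. For n = 1 the series Z(s) is zeta(s, -z_j), and it is expanded around w = 0 with the same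
  tail and the same Y as the product. All transcendental contributions are then the same expressions
  and cancel, and residues enter only at w = 0. The chain rule for the argument n s cancels the
  factor 1 / n everywhere except in the quadratic terms.\<close>

lemma
  fixes f :: "'a \<Rightarrow> complex \<Rightarrow> complex"
  assumes "open U"
    and holo: "\<And>k. k \<in> A \<Longrightarrow> f k holomorphic_on U"
    and bound: "\<And>z. z \<in> U \<Longrightarrow> \<exists>d>0. \<exists>M. M summable_on A \<and>
                  (\<forall>k\<in>A. \<forall>y\<in>cball z d \<inter> U. norm (f k y) \<le> M k)"
  shows summable_on_locally_bounded: "\<And>z. z \<in> U \<Longrightarrow> (\<lambda>k. f k z) summable_on A"
    and holomorphic_on_infsum: "(\<lambda>z. \<Sum>\<^sub>\<infinity>k\<in>A. f k z) holomorphic_on U"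
    and deriv_infsum: "\<And>z. z \<in> U \<Longrightarrow>
          ((\<lambda>k. deriv (f k) z) has_sum deriv (\<lambda>z. \<Sum>\<^sub>\<infinity>k\<in>A. f k z) z) A"
proof -
  have *: "(\<lambda>k. f k z) summable_on A \<and>
     (\<exists>d>0. (\<lambda>z. \<Sum>\<^sub>\<infinity>k\<in>A. f k z) holomorphic_on ball z d) \<and>
     ((\<lambda>k. deriv (f k) z) has_sum deriv (\<lambda>z. \<Sum>\<^sub>\<infinity>k\<in>A. f k z) z) A"
    if z: "z \<in> U" for z
  proof -
    obtain d M where d: "d > 0" and M: "M summable_on A"
      and le: "\<And>k y. k \<in> A \<Longrightarrow> y \<in> cball z d \<inter> U \<Longrightarrow> norm (f k y) \<le> M k"
      using bound[OF z] by blast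
    obtain e where e: "e > 0" "cball z e \<subseteq> U"
      using \<open>open U\<close> z open_contains_cball by blast
    define r where "r = min d e"
    have r: "r > 0" "cball z r \<subseteq> cball z d \<inter> U"
      using d e by (auto simp: r_def)
    \<comment> \<open>The M-test gives uniform convergence along the net of finite subsets of
      \<open>A\<close>, so limits of functions and of derivatives are taken without enumerating the
      index set.\<close>
    have lim: "uniform_limit (cball z r) (\<lambda>X y. \<Sum>k\<in>X. f k y) (\<lambda>y. \<Sum>\<^sub>\<infinity>k\<in>A. f k y)
                 (finite_subsets_at_top A)"
      by (rule Weierstrass_m_test_general[OF _ M]) (use le r in blast)
    have hol: "(\<lambda>y. \<Sum>k\<in>X. f k y) holomorphic_on U" if "X \<subseteq> A" for X
      using that holo by (intro holomorphic_intros) auto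
    have ev: "\<forall>\<^sub>F X in finite_subsets_at_top A. X \<subseteq> A \<and> finite X"
      using eventually_finite_subsets_at_top_weakI[of A "\<lambda>X. X \<subseteq> A \<and> finite X"] by blast
    have 1: "(\<lambda>z. \<Sum>\<^sub>\<infinity>k\<in>A. f k z) holomorphic_on ball z r"
    proof (rule holomorphic_uniform_limit[OF _ lim])
      show "\<forall>\<^sub>F X in finite_subsets_at_top A. continuous_on (cball z r) (\<lambda>y. \<Sum>k\<in>X. f k y) \<and>
              (\<lambda>y. \<Sum>k\<in>X. f k y) holomorphic_on ball z r"
        using ev
      proof eventually_elim
        case (elim X)
        then show ?case
          using holomorphic_on_imp_continuous_on[OF hol[of X]] hol[of X] r ball_subset_cball[of z r]
          by (auto elim!: continuous_on_subset holomorphic_on_subset)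
      qed
    qed (use r in auto)
    have "((\<lambda>X. (deriv ^^ 1) (\<lambda>y. \<Sum>k\<in>X. f k y) z) \<longlongrightarrow>
             (deriv ^^ 1) (\<lambda>z. \<Sum>\<^sub>\<infinity>k\<in>A. f k z) z) (finite_subsets_at_top A)"
    proof (rule higher_deriv_complex_uniform_limit)
      show "uniform_limit (ball z r) (\<lambda>X y. \<Sum>k\<in>X. f k y) (\<lambda>y. \<Sum>\<^sub>\<infinity>k\<in>A. f k y)
                 (finite_subsets_at_top A)"
        using lim by (rule uniform_limit_on_subset) auto
      show "\<forall>\<^sub>F X in finite_subsets_at_top A. (\<lambda>y. \<Sum>k\<in>X. f k y) holomorphic_on ball z r"
        using ev
      proof eventually_elim
        case (elim X)
        then show ?case
          using hol[of X] r ball_subset_cball[of z r] by (auto elim!: holomorphic_on_subset)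
      qed
    qed (use r in auto)
    moreover have "\<forall>\<^sub>F X in finite_subsets_at_top A.
        (deriv ^^ 1) (\<lambda>y. \<Sum>k\<in>X. f k y) z = (\<Sum>k\<in>X. deriv (f k) z)"
      using ev
    proof eventually_elim
      case (elim X)
      have "f k field_differentiable at z" if "k \<in> X" for k
        using holo[of k] that elim z \<open>open U\<close>
        by (meson holomorphic_on_imp_differentiable_at subsetD)
      then have "((\<lambda>y. \<Sum>k\<in>X. f k y) has_field_derivative (\<Sum>k\<in>X. deriv (f k) z)) (at z)"
        by (intro DERIV_sum) (auto simp: DERIV_deriv_iff_field_differentiable)
      then show ?case by (simp add: DERIV_imp_deriv)
    qed
    ultimately have 2: "((\<lambda>k. deriv (f k) z) has_sum deriv (\<lambda>z. \<Sum>\<^sub>\<infinity>k\<in>A. f k z) z) A"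
      unfolding has_sum_def by (simp add: tendsto_cong)
    have "(\<lambda>k. norm (f k z)) summable_on A"
      by (rule Infinite_Sum.abs_summable_on_comparison_test'[OF M le]) (use d z in auto)
    then have "(\<lambda>k. f k z) summable_on A"
      by (rule abs_summable_summable)
    with 1 2 r show ?thesis by blast
  qed
  show "\<And>z. z \<in> U \<Longrightarrow> (\<lambda>k. f k z) summable_on A"
    "\<And>z. z \<in> U \<Longrightarrow> ((\<lambda>k. deriv (f k) z) has_sum deriv (\<lambda>z. \<Sum>\<^sub>\<infinity>k\<in>A. f k z) z) A"
    using * by blast+
  have "(\<lambda>z. \<Sum>\<^sub>\<infinity>k\<in>A. f k z) field_differentiable at z" if "z \<in> U" for z
    using *[OF that] by (meson centre_in_ball holomorphic_on_imp_differentiable_at open_ball)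
  then show "(\<lambda>z. \<Sum>\<^sub>\<infinity>k\<in>A. f k z) holomorphic_on U"
    by (simp add: holomorphic_on_def field_differentiable_at_within)
qed

text \<open>Cauchy's inequality bounds the j-th coefficient by B / r^j, so the series from j = K on
  is dominated by a geometric one of ratio |u| / r. Halving the radius makes the ratio at most 1/2,
  whence the factor 2.\<close>

lemma norm_le_power_of_vanishing_coeffs:
  fixes f :: "complex \<Rightarrow> complex"
  assumes "r > 0" and cont: "continuous_on (cball 0 r) f" and holo: "f holomorphic_on ball 0 r"
    and B: "\<And>u. norm u \<le> r \<Longrightarrow> norm (f u) \<le> B"
    and F: "f has_fps_expansion F" and F0: "\<And>j. j < K \<Longrightarrow> fps_nth F j = 0"
    and u: "norm u \<le> r / 2"
  shows "norm (f u) \<le> 2 * B * (norm u / r) ^ K"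
proof -
  define q where "q = norm u / r"
  have q: "0 \<le> q" "q \<le> 1/2" using u \<open>r > 0\<close> by (auto simp: q_def field_simps)
  have B0: "B \<ge> 0" using norm_ge_zero[of "f 0"] B[of 0] \<open>r > 0\<close> by (simp del: norm_ge_zero)
  have coeff: "fps_nth F j = (deriv ^^ j) f 0 / fact j" for j
    using F by (simp add: fps_nth_fps_expansion)
  have cauchy: "norm (fps_nth F j) \<le> B / r ^ j" for j
  proof -
    have "norm ((deriv ^^ j) f 0) \<le> fact j * B / r ^ j"
      by (rule Cauchy_inequality[OF holo cont \<open>r > 0\<close>]) (use B in auto)
    then have "norm ((deriv ^^ j) f 0) / fact j \<le> (fact j * B / r ^ j) / fact j"
      by (intro divide_right_mono) auto
    then show ?thesis by (simp add: coeff norm_divide)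
  qed
  have "norm u < r" using u \<open>r > 0\<close> by linarith
  then have s: "(\<lambda>j. fps_nth F j * u ^ j) sums f u"
    using holomorphic_power_series[OF holo, of u] by (simp add: coeff)
  define g where "g j = B * q ^ K * q ^ j" for j
  have gs: "g sums (B * q ^ K * (1 / (1 - q)))"
    unfolding g_def by (intro sums_mult geometric_sums) (use q in auto)
  have "(\<lambda>j. fps_nth F (j + K) * u ^ (j + K)) sums f u"
    using s by (subst sums_zero_iff_shift) (auto simp: F0)
  then have *: "f u = (\<Sum>j. fps_nth F (j + K) * u ^ (j + K))"
    by (simp add: sums_iff)
  have le: "norm (fps_nth F (j + K) * u ^ (j + K)) \<le> g j" for j
  proof -
    have "norm (fps_nth F (j + K) * u ^ (j + K)) \<le> B / r ^ (j + K) * norm u ^ (j + K)"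
      unfolding norm_mult norm_power by (intro mult_right_mono cauchy) auto
    also have "\<dots> = g j"
      by (simp add: g_def q_def power_divide power_add mult_ac)
    finally show ?thesis .
  qed
  have "norm (f u) \<le> suminf g"
    unfolding * by (rule norm_suminf_le[OF le sums_summable[OF gs]])
  also have "\<dots> = B * q ^ K * (1 / (1 - q))" using gs by (simp add: sums_iff)
  also have "\<dots> \<le> B * q ^ K * 2"
    by (intro mult_left_mono) (use q B0 in \<open>auto simp: field_simps\<close>)
  finally show ?thesis by (simp add: q_def mult_ac)
qed

text \<open>Joint continuity on the compact product of disc and parameter set supplies one bound for
  all s, so the constant in the Taylor estimate does not depend on s.\<close>

lemma uniform_bound_of_vanishing_coeffs:
  fixes H :: "complex \<Rightarrow> complex \<Rightarrow> complex"
  assumes r: "r > 0" and C: "compact C"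
    and cont: "continuous_on (cball 0 r \<times> C) (\<lambda>p. H (fst p) (snd p))"
    and holo: "\<And>s. (\<lambda>u. H u s) holomorphic_on cball 0 r"
    and fps: "\<And>s. \<exists>F. (\<lambda>u. H u s) has_fps_expansion F \<and> (\<forall>j<K. fps_nth F j = 0)"
  shows "\<exists>M. \<forall>s\<in>C. \<forall>u. norm u \<le> r / 2 \<longrightarrow> norm (H u s) \<le> M * norm u ^ K"
proof -
  have "bounded ((\<lambda>p. H (fst p) (snd p)) ` (cball 0 r \<times> C))"
    using cont by (intro compact_imp_bounded compact_continuous_image compact_Times C compact_cball)
  then obtain M where M: "\<And>u s. norm u \<le> r \<Longrightarrow> s \<in> C \<Longrightarrow> norm (H u s) \<le> M"
    unfolding bounded_iff by fastforce
  have "norm (H u s) \<le> 2 * M / r ^ K * norm u ^ K"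
    if s: "s \<in> C" and u: "norm u \<le> r / 2" for u s
  proof -
    obtain F where F: "(\<lambda>u. H u s) has_fps_expansion F" "\<And>j. j < K \<Longrightarrow> fps_nth F j = 0"
      using fps by blast
    have "norm (H u s) \<le> 2 * M * (norm u / r) ^ K"
    proof (rule norm_le_power_of_vanishing_coeffs[OF r _ _ _ F u])
      show "continuous_on (cball 0 r) (\<lambda>u. H u s)"
        by (rule holomorphic_on_imp_continuous_on[OF holo])
      show "(\<lambda>u. H u s) holomorphic_on ball 0 r"
        by (rule holomorphic_on_subset[OF holo]) auto
    qed (use M s in auto)
    then show ?thesis by (simp add: power_divide)
  qed
  then show ?thesis by blast
qed

text \<open>Both x and 1 + h / x have arguments in (-pi/2, pi/2), so the sum of the two principal
  logarithms stays in the principal strip.\<close>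

lemma powr_add_right_half_plane:
  fixes x h b :: complex
  assumes x: "Re x > 0" and h: "norm h < norm x"
  shows "(x + h) powr b = x powr b * (1 + h / x) powr b"
proof -
  have x0: "x \<noteq> 0" using x by auto
  have "norm (h / x) < 1" using h x0 by (simp add: norm_divide)
  then have re: "Re (1 + h / x) > 0"
    using complex_Re_le_cmod[of "- (h / x)"] by simp
  then have h0: "1 + h / x \<noteq> 0" by (metis less_irrefl zero_complex.sel(1))
  have "\<bar>Im (Ln x)\<bar> < pi / 2" "\<bar>Im (Ln (1 + h / x))\<bar> < pi / 2"
    using x re x0 h0 Re_Ln_pos_lt by blast+
  then have "Ln (x * (1 + h / x)) = Ln x + Ln (1 + h / x)"
    by (intro Ln_times_simple x0 h0) auto
  moreover have "x * (1 + h / x) = x + h" using x0 by (simp add: field_simps)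
  moreover have "x + h \<noteq> 0" using x0 h0 calculation(2) mult_eq_0_iff by metis
  ultimately show ?thesis using x0 h0
    by (simp add: powr_def exp_add[symmetric] algebra_simps)
qed

text \<open>The argument of x is at most pi in absolute value. The resulting exponential factor is
  locally bounded in b, which leaves convergence to the power of |x|.\<close>

lemma norm_powr_le:
  fixes x b :: complex
  assumes "x \<noteq> 0"
  shows "norm (x powr b) \<le> norm x powr Re b * exp (pi * \<bar>Im b\<bar>)"
proof -
  have "norm (x powr b) = norm x powr Re b * exp (- Im b * Im (Ln x))"
    using assms by (simp add: powr_def norm_exp_eq_Re exp_diff exp_minus field_simps)
  also have "\<dots> \<le> norm x powr Re b * exp (\<bar>Im b\<bar> * pi)"
  proof -
    have "- Im b * Im (Ln x) \<le> \<bar>Im b\<bar> * \<bar>Im (Ln x)\<bar>"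
      by (metis abs_ge_minus_self abs_mult minus_mult_left)
    also have "\<dots> \<le> \<bar>Im b\<bar> * pi"
      using mpi_less_Im_Ln[OF assms] Im_Ln_le_pi[OF assms] by (intro mult_left_mono) auto
    finally show ?thesis by (intro mult_left_mono) auto
  qed
  finally show ?thesis
    by (simp add: mult.commute)
qed

lemma holomorphic_on_compose_entire:
  "Y holomorphic_on UNIV \<Longrightarrow> g holomorphic_on S \<Longrightarrow> (\<lambda>x. Y (g x)) holomorphic_on S"
  using holomorphic_on_compose_gen[of g S Y UNIV] by (simp add: o_def)

text \<open>On a connected open set a meromorphic f - g either vanishes or avoids 0, both up to a
  sparse set; zeros on an open set exclude the second case. Agreement is punctured because values at
  poles are arbitrary.\<close>

lemma meromorphic_on_eventually_eq:
  assumes f: "f meromorphic_on D" and g: "g meromorphic_on D"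
    and D: "open D" "connected D" and U: "open U" "U \<noteq> {}" "U \<subseteq> D"
    and eq: "\<And>z. z \<in> U \<Longrightarrow> f z = g z" and z: "z \<in> D"
  shows "eventually (\<lambda>z. f z = g z) (at z)"
proof -
  obtain z0 where z0: "z0 \<in> U" using U by auto
  have mer: "(\<lambda>z. f z - g z) meromorphic_on D"
    using f g by (intro meromorphic_intros)
  have "\<not> eventually (\<lambda>z. f z - g z \<noteq> 0) (cosparse D)"
  proof
    assume "eventually (\<lambda>z. f z - g z \<noteq> 0) (cosparse D)"
    then have "eventually (\<lambda>z. f z - g z \<noteq> 0) (at z0)"
      using D z0 U by (auto simp: eventually_cosparse_open_eq)
    moreover have "eventually (\<lambda>z. z \<in> U) (at z0)"
      using U z0 by (intro eventually_at_in_open') auto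
    ultimately have "eventually (\<lambda>z. False) (at z0)"
      by eventually_elim (use eq in auto)
    then show False by simp
  qed
  then have "eventually (\<lambda>z. f z - g z = 0) (cosparse D)"
    using meromorphic_imp_constant_or_avoid[OF mer D] by blast
  then show ?thesis
    using D z by (auto simp: eventually_cosparse_open_eq)
qed

text \<open>Punctured agreement decides poles and limits alike, and the normalization fixes the
  value in either case. This is the uniqueness behind the definite description in
  \<open>barnes_zeta\<close>.\<close>

lemma nicely_meromorphic_on_eqI:
  assumes f: "f nicely_meromorphic_on UNIV" and g: "g nicely_meromorphic_on UNIV"
    and U: "open U" "U \<noteq> {}" and eq: "\<And>z. z \<in> U \<Longrightarrow> f z = g z"
  shows "f = g"
proof
  fix z
  have mer: "f meromorphic_on UNIV" "g meromorphic_on UNIV"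
    using f g by (auto simp: nicely_meromorphic_on_def)
  have ev: "eventually (\<lambda>z. f z = g z) (at z)"
    by (rule meromorphic_on_eventually_eq[OF mer _ _ U]) (use eq in auto)
  have fz: "is_pole f z \<and> f z = 0 \<or> f \<midarrow>z\<rightarrow> f z" and gz: "is_pole g z \<and> g z = 0 \<or> g \<midarrow>z\<rightarrow> g z"
    using f g by (auto simp: nicely_meromorphic_on_def)
  have pole: "is_pole f z \<longleftrightarrow> is_pole g z"
    by (rule is_pole_cong) (use ev in auto)
  have lim: "f \<midarrow>z\<rightarrow> f z \<Longrightarrow> g \<midarrow>z\<rightarrow> f z"
    using tendsto_cong[OF ev] by blast
  have npf: "\<not> (is_pole f z \<and> f \<midarrow>z\<rightarrow> f z)"
    unfolding is_pole_def using not_tendsto_and_filterlim_at_infinity[of "at z"] by auto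
  have npg: "\<not> (is_pole g z \<and> g \<midarrow>z\<rightarrow> g z)"
    unfolding is_pole_def using not_tendsto_and_filterlim_at_infinity[of "at z"] by auto
  show "f z = g z"
  proof (cases "is_pole f z")
    case True
    then show ?thesis using pole fz gz npf npg by auto
  next
    case False
    then have "g \<midarrow>z\<rightarrow> f z" "g \<midarrow>z\<rightarrow> g z" using pole fz gz lim by auto
    then show ?thesis by (rule LIM_unique)
  qed
qed

section \<open>Sums over multi-indices\<close>

definition index_size :: "nat \<Rightarrow> (nat \<Rightarrow> nat) \<Rightarrow> nat" where
  "index_size N k = (\<Sum>i=1..N. k i)"

definition index_tail :: "nat \<Rightarrow> nat \<Rightarrow> (nat \<Rightarrow> nat) set" where
  "index_tail N L = {k \<in> multi_indices N. L \<le> index_size N k}"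

definition index_shift :: "nat \<Rightarrow> (nat \<Rightarrow> nat) \<Rightarrow> nat set \<Rightarrow> nat \<Rightarrow> nat" where
  "index_shift N k A = (\<lambda>i\<in>{1..N}. k i + of_bool (i \<in> A))"

lemma index_tail_subset: "index_tail N L \<subseteq> multi_indices N"
  by (auto simp: index_tail_def)

lemma finite_index_complement: "finite (multi_indices N - index_tail N L)"
proof (rule finite_subset)
  show "multi_indices N - index_tail N L \<subseteq> {1..N} \<rightarrow>\<^sub>E {..<L}"
  proof
    fix k assume "k \<in> multi_indices N - index_tail N L"
    then have k: "k \<in> {1..N} \<rightarrow>\<^sub>E UNIV" "index_size N k < L"
      by (auto simp: multi_indices_def index_tail_def)
    have "k i < L" if "i \<in> {1..N}" for i
      using member_le_sum[of i "{1..N}" k] that k(2) by (simp add: index_size_def)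
    then show "k \<in> {1..N} \<rightarrow>\<^sub>E {..<L}" using k(1) by (auto simp: PiE_iff)
  qed
  show "finite ({1..N} \<rightarrow>\<^sub>E {..<L})" by (intro finite_PiE) auto
qed

lemma index_shift_in: "index_shift N k A \<in> multi_indices N"
  by (simp add: index_shift_def multi_indices_def)

text \<open>Shifts only raise coordinates. Hence differences taken at a point of the tail involve
  the tail alone, and cutting a function off outside it leaves them unchanged.\<close>

lemma index_shift_tail: "k \<in> index_tail N L \<Longrightarrow> index_shift N k A \<in> index_tail N L"
  using index_shift_in[of N k A]
  by (auto simp: index_tail_def index_size_def index_shift_def intro!: sum_mono elim!: order_trans)

lemma idot_index_shift:
  assumes "A \<subseteq> {1..N}"
  shows "idot N (index_shift N k A) \<omega> = idot N k \<omega> + sum \<omega> A"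
proof -
  have "(\<Sum>i\<in>{1..N}. of_bool (i \<in> A) * \<omega> i) = (\<Sum>i\<in>{1..N}. if i \<in> A then \<omega> i else 0)"
    by (rule sum.cong) auto
  also have "\<dots> = (\<Sum>i\<in>{1..N} \<inter> A. \<omega> i)"
    by (rule sum.inter_restrict[symmetric]) auto
  finally have "(\<Sum>i=1..N. of_bool (i \<in> A) * \<omega> i) = (\<Sum>i\<in>{1..N} \<inter> A. \<omega> i)" .
  moreover have "{1..N} \<inter> A = A" using assms by auto
  ultimately show ?thesis
    by (simp add: idot_def index_shift_def algebra_simps sum.distrib)
qed

text \<open>Each factor contributes \<open>h i\<close> or -1. For indicators this is
  inclusion-exclusion; for exponentials it turns translations by subset sums into a product of
  differences.\<close>

lemma alternating_sum_Pow:
  fixes h :: "'a \<Rightarrow> 'b :: comm_ring_1"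
  assumes "finite X"
  shows "(\<Sum>A\<in>Pow X. (-1) ^ (card X - card A) * (\<Prod>i\<in>A. h i)) = (\<Prod>i\<in>X. h i - 1)"
proof -
  have "(\<Prod>i\<in>X. h i + (-1)) = (\<Sum>A\<in>Pow X. (\<Prod>i\<in>A. h i) * (\<Prod>i\<in>X - A. -1))"
    by (rule prod_add[OF assms])
  also have "\<dots> = (\<Sum>A\<in>Pow X. (-1) ^ (card X - card A) * (\<Prod>i\<in>A. h i))"
    by (intro sum.cong) (auto simp: card_Diff_subset finite_subset[OF _ assms] mult.commute)
  finally show ?thesis by simp
qed

lemma has_sum_sum:
  fixes f :: "'a \<Rightarrow> 'b \<Rightarrow> 'c :: {topological_comm_monoid_add}"
  assumes "\<And>i. i \<in> I \<Longrightarrow> (f i has_sum s i) A"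
  shows "((\<lambda>k. \<Sum>i\<in>I. f i k) has_sum (\<Sum>i\<in>I. s i)) A"
  using assms by (induction I rule: infinite_finite_induct) (auto intro!: has_sum_add)

text \<open>The shift is a bijection onto the points whose coordinates in \<open>A\<close> are
  nonzero. The indicator form gives all \<open>A\<close> a common index set, so that the sums can be
  combined pointwise.\<close>

lemma has_sum_index_shift:
  fixes G :: "(nat \<Rightarrow> nat) \<Rightarrow> complex"
  assumes G: "G summable_on multi_indices N" and A: "A \<subseteq> {1..N}"
  shows "((\<lambda>k. G (index_shift N k A)) has_sum
          (\<Sum>\<^sub>\<infinity>k\<in>multi_indices N. if \<forall>i\<in>A. k i \<noteq> 0 then G k else 0)) (multi_indices N)"
proof -
  define T where "T = {k\<in>multi_indices N. \<forall>i\<in>A. k i \<noteq> 0}"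
  have bij: "bij_betw (\<lambda>k. index_shift N k A) (multi_indices N) T"
  proof (rule bij_betwI[where g = "\<lambda>k. \<lambda>i\<in>{1..N}. k i - of_bool (i \<in> A)"])
    show "(\<lambda>k. index_shift N k A) \<in> multi_indices N \<rightarrow> T"
      using A by (auto simp: T_def index_shift_def multi_indices_def)
    show "(\<lambda>k. \<lambda>i\<in>{1..N}. k i - of_bool (i \<in> A)) \<in> T \<rightarrow> multi_indices N"
      by (auto simp: multi_indices_def)
    show "(\<lambda>i\<in>{1..N}. index_shift N k A i - of_bool (i \<in> A)) = k"
      if "k \<in> multi_indices N" for k
      using that by (auto simp: index_shift_def multi_indices_def PiE_iff extensional_def fun_eq_iff)
    show "index_shift N (\<lambda>i\<in>{1..N}. k i - of_bool (i \<in> A)) A = k" if "k \<in> T" for k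
      using that by (auto simp: T_def index_shift_def multi_indices_def PiE_iff extensional_def fun_eq_iff)
  qed
  have "T \<subseteq> multi_indices N" by (auto simp: T_def)
  then have "(G has_sum infsum G T) T"
    using G by (meson has_sum_infsum summable_on_subset_banach)
  then have "((\<lambda>k. G (index_shift N k A)) has_sum infsum G T) (multi_indices N)"
    using has_sum_reindex_bij_betw[OF bij, of G] by simp
  moreover have "infsum G T = (\<Sum>\<^sub>\<infinity>k\<in>multi_indices N. if \<forall>i\<in>A. k i \<noteq> 0 then G k else 0)"
    by (rule infsum_cong_neutral) (auto simp: T_def)
  ultimately show ?thesis by simp
qed

text \<open>After reindexing, \<open>G k\<close> carries the weight prod_i ([k i \<noteq> 0] - 1),
  which vanishes unless k = 0, where it equals (-1)^N.\<close>

lemma has_sum_telescope: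
  fixes G :: "(nat \<Rightarrow> nat) \<Rightarrow> complex"
  assumes G: "G summable_on multi_indices N"
  shows "((\<lambda>k. \<Sum>A\<in>Pow {1..N}. (-1) ^ (N - card A) * G (index_shift N k A)) has_sum
          (-1) ^ N * G (\<lambda>i\<in>{1..N}. 0)) (multi_indices N)"
proof -
  define I where "I = multi_indices N"
  have s: "(\<lambda>k. if \<forall>i\<in>A. k i \<noteq> 0 then G k else 0) summable_on I" for A
  proof -
    have "G summable_on {k\<in>I. \<forall>i\<in>A. k i \<noteq> 0}"
      by (rule summable_on_subset_banach[OF G]) (auto simp: I_def)
    then show ?thesis
      by (rule summable_on_cong_neutral[THEN iffD1, rotated -1]) auto
  qed
  let ?S = "\<Sum>A\<in>Pow {1..N}. (-1) ^ (N - card A) *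
        (\<Sum>\<^sub>\<infinity>k\<in>I. if \<forall>i\<in>A. k i \<noteq> 0 then G k else 0)"
  have 1: "((\<lambda>k. \<Sum>A\<in>Pow {1..N}. (-1) ^ (N - card A) * G (index_shift N k A)) has_sum
?S) I"
    using has_sum_index_shift[OF G] unfolding I_def
    by (intro has_sum_sum has_sum_cmult_right) auto
  have 2: "((\<lambda>k. \<Sum>A\<in>Pow {1..N}. (-1) ^ (N - card A) *
                   (if \<forall>i\<in>A. k i \<noteq> 0 then G k else 0)) has_sum
?S) I"
    using s by (intro has_sum_sum has_sum_cmult_right has_sum_infsum) auto
  have 3: "(\<Sum>A\<in>Pow {1..N}. (-1) ^ (N - card A) * (if \<forall>i\<in>A. k i \<noteq> 0 then G k else 0)) =
       (if k = (\<lambda>i\<in>{1..N}. 0) then (-1) ^ N * G k else 0)" if k: "k \<in> I" for k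
  proof -
    have "(\<Sum>A\<in>Pow {1..N}. (-1) ^ (N - card A) * (if \<forall>i\<in>A. k i \<noteq> 0 then G k else 0)) =
          G k * (\<Sum>A\<in>Pow {1..N}. (-1) ^ (card {1..N} - card A) *
                   (\<Prod>i\<in>A. if k i \<noteq> 0 then 1 else (0::complex)))"
      unfolding sum_distrib_left
    proof (intro sum.cong refl)
      fix A assume "A \<in> Pow {1..N}"
      then have "finite A" by (auto intro: finite_subset)
      then show "(-1) ^ (N - card A) * (if \<forall>i\<in>A. k i \<noteq> 0 then G k else 0) =
         G k * ((-1) ^ (card {1..N} - card A) * (\<Prod>i\<in>A. if k i \<noteq> 0 then 1 else (0::complex)))"
        by auto
    qed
    also have "\<dots> = G k * (\<Prod>i=1..N. (if k i \<noteq> 0 then 1 else 0) - 1)"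
      by (subst alternating_sum_Pow) auto
    also have "\<dots> = (if k = (\<lambda>i\<in>{1..N}. 0) then (-1) ^ N * G k else 0)"
    proof (cases "k = (\<lambda>i\<in>{1..N}. 0)")
      case True
      then show ?thesis by simp
    next
      case False
      then obtain i where "i \<in> {1..N}" "k i \<noteq> 0"
        using k by (fastforce simp: I_def multi_indices_def PiE_iff extensional_def fun_eq_iff)
      then have "(\<Prod>i=1..N. (if k i \<noteq> 0 then 1 else 0) - (1::complex)) = 0"
        by (intro prod_zero) auto
      then show ?thesis using False by simp
    qed
    finally show ?thesis .
  qed
  have 4: "((\<lambda>k. if k = (\<lambda>i\<in>{1..N}. 0) then (-1) ^ N * G k else 0) has_sum
                  (-1) ^ N * G (\<lambda>i\<in>{1..N}. 0)) I"
  proof -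
    have "((\<lambda>k. (-1) ^ N * G k) has_sum (-1) ^ N * G (\<lambda>i\<in>{1..N}. 0)) {\<lambda>i\<in>{1..N}. 0}"
      using has_sum_finite[of "{\<lambda>i\<in>{1..N}. 0}" "\<lambda>k. (-1) ^ N * G k"] by simp
    then show ?thesis
      by (rule has_sum_cong_neutral[THEN iffD1, rotated -1]) (auto simp: I_def multi_indices_def)
  qed
  have "((\<lambda>k. if k = (\<lambda>i\<in>{1..N}. 0) then (-1) ^ N * G k else 0) has_sum ?S) I"
    using 2 by (rule has_sum_cong[THEN iffD1, rotated]) (rule 3)
  then have "?S = (-1) ^ N * G (\<lambda>i\<in>{1..N}. 0)"
    using 4 has_sum_unique by blast
  then show ?thesis using 1 by (simp add: I_def)
qed

text \<open>Since k i is at most the total size, the term is bounded by a product of one-dimensional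
  terms with exponent \<sigma> / N > 1.\<close>

lemma summable_on_index_size:
  assumes "N \<ge> 1" "\<sigma> > real N"
  shows "(\<lambda>k. (1 + real (index_size N k)) powr (- \<sigma>)) summable_on multi_indices N"
proof -
  define f :: "nat \<Rightarrow> real" where "f j = (1 + real j) powr (- \<sigma> / real N)" for j
  have "summable (\<lambda>j. real (Suc j) powr (- \<sigma> / real N))"
    by (subst summable_Suc_iff, subst summable_real_powr_iff) (use assms in \<open>auto simp: field_simps\<close>)
  moreover have "f = (\<lambda>j. real (Suc j) powr (- \<sigma> / real N))"
    by (auto simp: f_def fun_eq_iff add.commute)
  ultimately have "summable f" by (simp only:)
  moreover have "(\<lambda>j. norm (f j)) = f" by (simp add: f_def fun_eq_iff)
  ultimately have f: "f summable_on UNIV"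
    by (intro norm_summable_imp_summable_on) (simp only:)
  have "(\<lambda>k. \<Prod>i=1..N. f (k i)) summable_on multi_indices N"
  proof -
    have "(\<lambda>j. norm (f j)) summable_on UNIV" using f by (simp add: f_def[abs_def])
    then have "Infinite_Set_Sum.abs_summable_on f UNIV"
      by (simp only: abs_summable_equivalent)
    then have "Infinite_Set_Sum.abs_summable_on (\<lambda>k. \<Prod>i=1..N. f (k i)) ({1..N} \<rightarrow>\<^sub>E UNIV)"
      by (intro abs_summable_on_prod_PiE) (auto simp: f_def)
    then have "(\<lambda>k. norm (\<Prod>i=1..N. f (k i))) summable_on multi_indices N"
      by (simp only: abs_summable_equivalent[symmetric] multi_indices_def)
    then show ?thesis by (rule abs_summable_summable)
  qed
  then show ?thesis
  proof (rule summable_on_comparison_test)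
    fix k assume "k \<in> multi_indices N"
    define S where "S = 1 + real (index_size N k)"
    have S: "S > 0" by (simp add: S_def)
    have "S powr (- \<sigma>) = (\<Prod>i=1..N. S powr (- \<sigma> / real N))"
      using assms S by (simp add: powr_realpow[symmetric] powr_powr)
    also have "\<dots> \<le> (\<Prod>i=1..N. f (k i))"
    proof (intro prod_mono conjI)
      fix i assume i: "i \<in> {1..N}"
      have "k i \<le> index_size N k"
        unfolding index_size_def by (rule member_le_sum) (use i in auto)
      then show "S powr (- \<sigma> / real N) \<le> f (k i)"
        unfolding f_def S_def using assms by (intro powr_mono2') (auto simp: field_simps)
    qed auto
    finally show "(1 + real (index_size N k)) powr (- \<sigma>) \<le> (\<Prod>i=1..N. f (k i))"
      by (simp add: S_def)
  qed auto
qed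

section \<open>Continuation of the lattice zeta function\<close>

text \<open>All \<open>Y K\<close> agree for Re s > a, hence by the identity theorem any two agree
  on the smaller of their half-planes; these exhaust the plane.\<close>

lemma holomorphic_glue_half_planes:
  fixes Y :: "nat \<Rightarrow> complex \<Rightarrow> complex"
  assumes holo: "\<And>K. Y K holomorphic_on {s. Re s > a - real K}"
    and eq: "\<And>K s. Re s > a \<Longrightarrow> Y K s = Y 0 s"
  shows "\<exists>Z. Z holomorphic_on UNIV \<and> (\<forall>K s. Re s > a - real K \<longrightarrow> Z s = Y K s)"
proof -
  have agree: "Y K s = Y K' s" if "K \<le> K'" "Re s > a - real K" for K K' s
  proof (rule analytic_continuation_open[of "{s. Re s > a}" "{s. Re s > a - real K}" "Y K" "Y K'" s])
    show "open {s. Re s > a}" by (rule open_halfspace_Re_gt)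
    show "open {s. Re s > a - real K}" by (rule open_halfspace_Re_gt)
    show "{s. Re s > a} \<noteq> {}"
      by (auto intro!: exI[of _ "of_real (a + 1)"])
    show "connected {s. Re s > a - real K}"
      by (intro convex_connected convex_halfspace_Re_gt)
    show "Y K holomorphic_on {s. Re s > a - real K}" by (rule holo)
    show "Y K' holomorphic_on {s. Re s > a - real K}"
      by (rule holomorphic_on_subset[OF holo[of K']]) (use that in auto)
    show "{s. Re s > a} \<subseteq> {s. Re s > a - real K}" by auto
    show "Y K z = Y K' z" if "z \<in> {s. Re s > a}" for z
      using eq[of z K] eq[of z K'] that by (metis mem_Collect_eq)
  qed (use that in auto)
  \<comment> \<open>Some index whose half-plane contains s; the added 1 makes the inequality
    strict.\<close>
  define K0 where "K0 s = nat (\<lceil>a - Re s\<rceil> + 1)" for s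
  have K0: "Re s > a - real (K0 s)" for s
    unfolding K0_def by linarith
  define Z where "Z s = Y (K0 s) s" for s
  have Z: "Z s = Y K s" if "Re s > a - real K" for K s
  proof (cases "K \<le> K0 s")
    case True
    then show ?thesis unfolding Z_def by (rule agree[OF _ that, symmetric])
  next
    case False
    then show ?thesis unfolding Z_def by (intro agree K0) auto
  qed
  have "Z field_differentiable at s" for s
  proof -
    have *: "open {t. Re t > a - real (K0 s)}" by (rule open_halfspace_Re_gt)
    have "Z holomorphic_on {t. Re t > a - real (K0 s)}"
      by (rule holomorphic_transform[OF holo]) (use Z in auto)
    then show ?thesis
      by (rule holomorphic_on_imp_differentiable_at[OF _ *]) (use K0[of s] in auto)
  qed
  then have "Z holomorphic_on UNIV"
    by (auto simp: holomorphic_on_def field_differentiable_at_within)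
  then show ?thesis using Z by blast
qed

lemma gchoose_eq_prod: "(a :: complex) gchoose n = (\<Prod>i<n. a - of_nat i) / fact n"
  by (simp add: gbinomial_prod_rev lessThan_atLeast0)

section \<open>Lattice tails in the right half-plane\<close>

locale barnes_lattice =
  fixes N :: nat and \<omega> :: "nat \<Rightarrow> complex"
  assumes N_pos: "N \<ge> 1" and Re_omega: "\<And>i. i \<in> {1..N} \<Longrightarrow> Re (\<omega> i) > 0"
begin

abbreviation B :: "nat \<Rightarrow> complex" where
  "B n \<equiv> multi_bernoulli N n 0 \<omega>"

text \<open>The summand 1 makes the bound strict for every subset sum of the \<omega> i and keeps it
  away from 0.\<close>

definition omega_bound :: real where
  "omega_bound = 1 + (\<Sum>i=1..N. norm (\<omega> i))"

text \<open>Linear growth gives convergence over the tail; the bound \<rho> puts 1 / x into the disc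
  of radius 1 / \<rho> on which Taylor remainders are controlled.\<close>

definition admissible :: "complex \<Rightarrow> nat \<Rightarrow> real \<Rightarrow> bool" where
  "admissible w L \<rho> \<longleftrightarrow> L \<ge> 1 \<and>
     (\<exists>c>0. \<forall>k\<in>index_tail N L. c * (1 + real (index_size N k)) \<le> Re (idot N k \<omega> + w)) \<and>
     (\<forall>k\<in>index_tail N L. \<rho> \<le> Re (idot N k \<omega> + w))"

definition zeta_tail :: "complex \<Rightarrow> nat \<Rightarrow> complex \<Rightarrow> complex" where
  "zeta_tail w L s = (\<Sum>\<^sub>\<infinity>k\<in>index_tail N L. (idot N k \<omega> + w) powr (- s))"

definition pole_poly :: "complex \<Rightarrow> complex" where
  "pole_poly s = (\<Prod>i=1..N. of_nat i - s)"

lemma norm_sum_omega_less: "A \<subseteq> {1..N} \<Longrightarrow> norm (sum \<omega> A) < omega_bound"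
proof -
  assume "A \<subseteq> {1..N}"
  then have "norm (sum \<omega> A) \<le> (\<Sum>i=1..N. norm (\<omega> i))"
    by (intro order_trans[OF norm_sum] sum_mono2) auto
  then show ?thesis by (simp add: omega_bound_def)
qed

lemma omega_bound_ge_1: "omega_bound \<ge> 1"
  by (simp add: omega_bound_def sum_nonneg)

lemma Re_idot_ge: "\<exists>c>0. \<forall>k. c * real (index_size N k) \<le> Re (idot N k \<omega>)"
proof -
  define c where "c = Min ((\<lambda>i. Re (\<omega> i)) ` {1..N})"
  have "c > 0" unfolding c_def using N_pos Re_omega by (subst Min_gr_iff) auto
  moreover have "c * real (index_size N k) \<le> Re (idot N k \<omega>)" for k
  proof -
    have "c * real (index_size N k) = (\<Sum>i=1..N. c * real (k i))"
      by (simp add: index_size_def sum_distrib_left)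
    also have "\<dots> \<le> (\<Sum>i=1..N. Re (\<omega> i) * real (k i))"
      by (intro sum_mono mult_right_mono) (auto simp: c_def)
    also have "\<dots> = Re (idot N k \<omega>)" by (simp add: idot_def mult.commute)
    finally show ?thesis .
  qed
  ultimately show ?thesis by blast
qed

lemma eventually_admissible: "eventually (\<lambda>L. admissible w L \<rho>) sequentially"
proof -
  obtain c where c: "c > 0" "\<And>k. c * real (index_size N k) \<le> Re (idot N k \<omega>)"
    using Re_idot_ge by blast
  \<comment> \<open>With this choice w and \<rho> together use at most half of Re(k . omega). The
    other half still grows linearly, and c * S / 2 is at least c * (1 + S) / 4 because S \<ge>
    1.\<close>
  define L0 where "L0 = Suc (nat \<lceil>(2 * (norm w + \<bar>\<rho>\<bar>)) / c\<rceil>)"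
  have "admissible w L \<rho>" if L: "L \<ge> L0" for L
  proof -
    have "2 * (norm w + \<bar>\<rho>\<bar>) / c \<le> real L0" unfolding L0_def by linarith
    then have *: "2 * (norm w + \<bar>\<rho>\<bar>) \<le> c * real L"
      using L c(1) by (simp add: field_simps order_trans[OF _ mult_left_mono[of "real L0" "real L" c]])
    have L1: "L \<ge> 1" using L by (simp add: L0_def)
    have "c / 4 * (1 + real (index_size N k)) \<le> Re (idot N k \<omega> + w) \<and> \<rho> \<le> Re (idot N k \<omega> + w)"
      if k: "k \<in> index_tail N L" for k
    proof -
      define S where "S = real (index_size N k)"
      have S: "S \<ge> real L" "S \<ge> 1" using k L1 by (auto simp: S_def index_tail_def)
      have "c * real L \<le> c * S" using S c by (intro mult_left_mono) auto
      then have 1: "2 * (norm w + \<bar>\<rho>\<bar>) \<le> c * S" using * by linarith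
      have 2: "c * 1 \<le> c * S" using S c by (intro mult_left_mono) auto
      have 3: "c * S \<le> Re (idot N k \<omega>)" using c by (simp add: S_def)
      have 4: "- norm w \<le> Re w" "0 \<le> norm w" using abs_Re_le_cmod[of w] by linarith+
      define T where "T = c * S"
      have 5: "c / 4 * (1 + S) = c / 4 + T / 4" by (simp add: T_def algebra_simps)
      have 6: "\<rho> \<le> \<bar>\<rho>\<bar>" "0 \<le> \<bar>\<rho>\<bar>" by simp_all
      have "T / 2 \<le> Re (idot N k \<omega>) + Re w" "\<rho> \<le> Re (idot N k \<omega>) + Re w"
        using 1[folded T_def] 3[folded T_def] 4 6 by argo+
      moreover have "c / 4 + T / 4 \<le> T / 2" using 2[folded T_def] by simp
      ultimately show ?thesis
        unfolding S_def[symmetric] plus_complex.sel 5 by linarith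
    qed
    moreover have "c / 4 > 0" using c(1) by simp
    ultimately show ?thesis unfolding admissible_def using L1
      by (intro conjI exI[of _ "c / 4"] ballI) auto
  qed
  then show ?thesis by (auto simp: eventually_sequentially)
qed

lemma summable_norm_tail:
  assumes adm: "admissible w L \<rho>" and \<sigma>: "\<sigma> > real N"
  shows "(\<lambda>k. norm (idot N k \<omega> + w) powr (- \<sigma>)) summable_on index_tail N L"
proof -
  obtain c where c: "c > 0"
    "\<And>k. k \<in> index_tail N L \<Longrightarrow> c * (1 + real (index_size N k)) \<le> Re (idot N k \<omega> + w)"
    using adm by (auto simp: admissible_def)
  have "(\<lambda>k. c powr (- \<sigma>) * (1 + real (index_size N k)) powr (- \<sigma>)) summable_on index_tail N L"
    by (intro summable_on_cmult_right
          summable_on_subset_banach[OF summable_on_index_size[OF N_pos \<sigma>] index_tail_subset])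
  then show ?thesis
  proof (rule summable_on_comparison_test)
    fix k assume k: "k \<in> index_tail N L"
    have "norm (idot N k \<omega> + w) powr (- \<sigma>) \<le> (c * (1 + real (index_size N k))) powr (- \<sigma>)"
      using c(1) c(2)[OF k] complex_Re_le_cmod[of "idot N k \<omega> + w"] \<sigma>
      by (intro powr_mono2') auto
    also have "\<dots> = c powr (- \<sigma>) * (1 + real (index_size N k)) powr (- \<sigma>)"
      using c(1) by (simp add: powr_mult)
    finally show "norm (idot N k \<omega> + w) powr (- \<sigma>)
        \<le> c powr (- \<sigma>) * (1 + real (index_size N k)) powr (- \<sigma>)" .
  qed auto
qed

text \<open>The terms have size |x| to the power e - n Re s - K, and \<open>U\<close> says that this
  exponent is below -N. Three series are instances: the zeta series itself (H = 1), the error of the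
  antidifference (e = N), and the remainder of the product (K = N + 1).\<close>

lemma
  fixes H :: "complex \<Rightarrow> complex \<Rightarrow> complex" and w :: complex and L n e K :: nat
  defines "g \<equiv> \<lambda>k s. (idot N k \<omega> + w) powr (of_nat e - of_nat n * s) * H (1 / (idot N k \<omega> + w)) s"
    and "U \<equiv> {s. real N + real e - real K < real n * Re s}"
  assumes adm: "admissible w L \<rho>" and \<rho>: "\<rho> \<ge> 1" and n: "n \<ge> 1"
    and holo: "\<And>u. norm u \<le> 1 / \<rho> \<Longrightarrow> H u holomorphic_on UNIV"
    and bound: "\<And>C. compact C \<Longrightarrow>
       \<exists>M. \<forall>s\<in>C. \<forall>u. norm u \<le> 1 / \<rho> \<longrightarrow> norm (H u s) \<le> M * norm u ^ K"
  shows lattice_series_summable: "\<And>s. s \<in> U \<Longrightarrow> (\<lambda>k. g k s) summable_on index_tail N L"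
    and lattice_series_holomorphic: "(\<lambda>s. \<Sum>\<^sub>\<infinity>k\<in>index_tail N L. g k s) holomorphic_on U"
    and lattice_series_deriv: "\<And>s. s \<in> U \<Longrightarrow> ((\<lambda>k. deriv (g k) s) has_sum
           deriv (\<lambda>s. \<Sum>\<^sub>\<infinity>k\<in>index_tail N L. g k s) s) (index_tail N L)"
proof -
  have x: "Re (idot N k \<omega> + w) \<ge> \<rho>" "idot N k \<omega> + w \<noteq> 0" "norm (idot N k \<omega> + w) \<ge> 1"
    "norm (1 / (idot N k \<omega> + w)) \<le> 1 / \<rho>" if "k \<in> index_tail N L" for k
  proof -
    show *: "Re (idot N k \<omega> + w) \<ge> \<rho>" using adm that by (auto simp: admissible_def)
    then have **: "norm (idot N k \<omega> + w) \<ge> \<rho>"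
      using complex_Re_le_cmod order_trans by blast
    then show "norm (idot N k \<omega> + w) \<ge> 1" "idot N k \<omega> + w \<noteq> 0" using \<rho> by auto
    then show "norm (1 / (idot N k \<omega> + w)) \<le> 1 / \<rho>"
      using ** \<rho> by (simp add: norm_divide frac_le)
  qed
  have oU: "open U"
  proof -
    have "U = (\<lambda>s. real n * Re s) -` {real N + real e - real K <..}"
      by (auto simp: U_def)
    then show ?thesis by (simp add: open_vimage continuous_intros)
  qed
  have hol: "g k holomorphic_on U" if "k \<in> index_tail N L" for k
  proof -
    have "H (1 / (idot N k \<omega> + w)) holomorphic_on U"
      using holo[OF x(4)[OF that]] by (rule holomorphic_on_subset) auto
    then show ?thesis
      unfolding g_def powr_def using x(2)[OF that] by (auto intro!: holomorphic_intros)
  qed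
  have bnd: "\<exists>d>0. \<exists>M. M summable_on index_tail N L \<and>
              (\<forall>k\<in>index_tail N L. \<forall>s\<in>cball s0 d \<inter> U. norm (g k s) \<le> M k)" if s0: "s0 \<in> U" for s0
  proof -
    \<comment> \<open>Half of the slack in the inequality defining \<open>U\<close>, so that
      \<sigma>, the worst exponent on the disc, still exceeds N.\<close>
    define d where "d = (real n * Re s0 - (real N + real e - real K)) / (2 * real n)"
    have d: "d > 0" using s0 n by (auto simp: d_def U_def)
    define \<sigma> where "\<sigma> = real n * (Re s0 - d) - real e + real K"
    have "real n * d = (real n * Re s0 - (real N + real e - real K)) / 2"
      using n by (simp add: d_def)
    then have \<sigma>: "\<sigma> > real N"
      using s0 by (simp add: \<sigma>_def U_def algebra_simps)
    obtain M where M: "\<And>s u. s \<in> cball s0 d \<Longrightarrow> norm u \<le> 1 / \<rho> \<Longrightarrow> norm (H u s) \<le> M * norm u ^ K"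
      using bound[OF compact_cball[of s0 d]] by blast
    define C where "C = \<bar>M\<bar> * exp (pi * (real n * (\<bar>Im s0\<bar> + d)))"
    have "norm (g k s) \<le> C * norm (idot N k \<omega> + w) powr (- \<sigma>)"
      if k: "k \<in> index_tail N L" and s: "s \<in> cball s0 d" for k s
    proof -
      define y where "y = idot N k \<omega> + w"
      note y = x[OF k, folded y_def]
      have sd: "\<bar>Re s0 - Re s\<bar> \<le> d" "\<bar>Im s0 - Im s\<bar> \<le> d"
        using s abs_Re_le_cmod[of "s0 - s"] abs_Im_le_cmod[of "s0 - s"] by (auto simp: dist_norm)
      have im: "real n * \<bar>Im s\<bar> \<le> real n * (\<bar>Im s0\<bar> + d)"
        by (intro mult_left_mono) (use sd in linarith)+
      have re: "real n * (Re s0 - d) \<le> real n * Re s"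
        by (intro mult_left_mono) (use sd in linarith)+
      have "norm (g k s) = norm (y powr (of_nat e - of_nat n * s)) * norm (H (1 / y) s)"
        by (simp add: g_def y_def norm_mult)
      also have "\<dots> \<le> (norm y powr (real e - real n * Re s) * exp (pi * (real n * \<bar>Im s\<bar>)))
                        * (\<bar>M\<bar> * norm (1 / y) ^ K)"
      proof (intro mult_mono)
        show "norm (y powr (of_nat e - of_nat n * s))
            \<le> norm y powr (real e - real n * Re s) * exp (pi * (real n * \<bar>Im s\<bar>))"
          using norm_powr_le[OF y(2), of "of_nat e - of_nat n * s"] by (simp add: abs_mult)
        have "norm (H (1 / y) s) \<le> M * norm (1 / y) ^ K" by (rule M[OF s y(4)])
        also have "\<dots> \<le> \<bar>M\<bar> * norm (1 / y) ^ K" by (intro mult_right_mono) auto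
        finally show "norm (H (1 / y) s) \<le> \<bar>M\<bar> * norm (1 / y) ^ K" .
      qed auto
      also have "\<dots> = (\<bar>M\<bar> * exp (pi * (real n * \<bar>Im s\<bar>))) *
                        norm y powr (real e - real n * Re s - real K)"
        using y(2) by (simp add: powr_diff powr_realpow norm_divide power_divide)
      also have "\<dots> \<le> C * norm y powr (- \<sigma>)"
        unfolding C_def using y(3) re im
        by (intro mult_mono powr_mono mult_left_mono) (auto simp: \<sigma>_def)
      finally show ?thesis by (simp add: y_def)
    qed
    moreover have "(\<lambda>k. C * norm (idot N k \<omega> + w) powr (- \<sigma>)) summable_on index_tail N L"
      by (intro summable_on_cmult_right summable_norm_tail[OF adm \<sigma>])
    ultimately show ?thesis using d
      by (intro exI[of _ d] conjI exI[of _ "\<lambda>k. C * norm (idot N k \<omega> + w) powr (- \<sigma>)"]) auto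
  qed
  show "\<And>s. s \<in> U \<Longrightarrow> (\<lambda>k. g k s) summable_on index_tail N L"
    by (rule summable_on_locally_bounded[OF oU hol bnd])
  show "(\<lambda>s. \<Sum>\<^sub>\<infinity>k\<in>index_tail N L. g k s) holomorphic_on U"
    by (rule holomorphic_on_infsum[OF oU hol bnd])
  show "\<And>s. s \<in> U \<Longrightarrow> ((\<lambda>k. deriv (g k) s) has_sum
           deriv (\<lambda>s. \<Sum>\<^sub>\<infinity>k\<in>index_tail N L. g k s) s) (index_tail N L)"
    by (rule deriv_infsum[OF oU hol bnd])
qed

lemma
  assumes adm: "admissible w L \<rho>" and \<rho>: "\<rho> \<ge> 1"
  shows zeta_tail_summable: "\<And>s. Re s > real N \<Longrightarrow>
           (\<lambda>k. (idot N k \<omega> + w) powr (- s)) summable_on index_tail N L"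
    and zeta_tail_holomorphic: "zeta_tail w L holomorphic_on {s. Re s > real N}"
proof -
  have b: "\<exists>M. \<forall>s\<in>C. \<forall>u::complex. norm u \<le> 1 / \<rho> \<longrightarrow> norm (1::complex) \<le> M * norm u ^ 0" for C :: "complex set"
    by (rule exI[of _ 1]) auto
  show "\<And>s. Re s > real N \<Longrightarrow>
           (\<lambda>k. (idot N k \<omega> + w) powr (- s)) summable_on index_tail N L"
    using lattice_series_summable[OF adm \<rho>, of 1 "\<lambda>u s. 1" 0 _ 0] b by simp
  show "zeta_tail w L holomorphic_on {s. Re s > real N}"
    using lattice_series_holomorphic[OF adm \<rho>, of 1 "\<lambda>u s. 1" 0 0] b
    by (simp add: zeta_tail_def[abs_def])
qed

section \<open>The difference operator and the Bernoulli numbers\<close>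

definition alternating_exp :: "complex fps" where
  "alternating_exp = (\<Sum>A\<in>Pow {1..N}. (-1) ^ (N - card A) * fps_exp (sum \<omega> A))"

lemma fps_nth_signed: "fps_nth ((-1) ^ a * f) m = (-1) ^ a * fps_nth (f :: complex fps) m"
  by (cases "even a") auto

text \<open>This series is the symbol of Delta_1 ... Delta_N in D. The expanded form lists the
  translations that occur in telescoping; the product form is the denominator of the Bernoulli
  generating function.\<close>

lemma alternating_exp_eq: "alternating_exp = (\<Prod>i=1..N. (fps_exp (\<omega> i) - 1))"
proof -
  have "(\<Prod>i\<in>A. fps_exp (\<omega> i)) = fps_exp (sum \<omega> A)" if "finite A" for A
    using that by (induction A) (auto simp: fps_exp_add_mult)
  then have "alternating_exp =
      (\<Sum>A\<in>Pow {1..N}. (-1) ^ (card {1..N} - card A) * (\<Prod>i\<in>A. fps_exp (\<omega> i)))"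
    unfolding alternating_exp_def by (intro sum.cong) (auto dest: finite_subset)
  also have "\<dots> = (\<Prod>i=1..N. (fps_exp (\<omega> i) - 1))" by (rule alternating_sum_Pow) auto
  finally show ?thesis .
qed

lemma alternating_exp_nz: "alternating_exp \<noteq> 0"
  and subdegree_alternating_exp: "subdegree alternating_exp = N"
proof -
  have nz: "fps_exp (\<omega> i) - 1 \<noteq> 0" and sd: "subdegree (fps_exp (\<omega> i) - 1) = 1"
    if "i \<in> {1..N}" for i
  proof -
    have "fps_nth (fps_exp (\<omega> i) - 1) 1 \<noteq> 0" using Re_omega[OF that] by auto
    then show "fps_exp (\<omega> i) - 1 \<noteq> 0" "subdegree (fps_exp (\<omega> i) - 1) = 1"
      by (auto intro!: subdegreeI)
  qed
  show "alternating_exp \<noteq> 0" unfolding alternating_exp_eq using nz by auto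
  have "subdegree alternating_exp = (\<Sum>i=1..N. subdegree (fps_exp (\<omega> i) - 1))"
    unfolding alternating_exp_eq using nz by (subst subdegree_prod) auto
  then show "subdegree alternating_exp = N" using sd by simp
qed

lemma fps_nth_alternating_exp:
  "fps_nth alternating_exp m = (\<Sum>A\<in>Pow {1..N}. (-1) ^ (N - card A) * (sum \<omega> A ^ m / fact m))"
  unfolding alternating_exp_def by (simp add: fps_sum_nth fps_nth_signed)

text \<open>Coefficientwise form of (X^N / G) * G = X^N for G = \<open>alternating_exp\<close>; the
  quotient is exact because G has order N.\<close>

lemma bernoulli_convolution:
  "(\<Sum>n\<le>j. B n / fact n *
      (\<Sum>A\<in>Pow {1..N}. (-1) ^ (N - card A) * (sum \<omega> A ^ (j - n) / fact (j - n)))) =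
   (if j = N then 1 else 0)"
proof -
  have "alternating_exp dvd fps_X ^ N"
    using alternating_exp_nz subdegree_alternating_exp by (subst fps_dvd_iff) auto
  then have "(fps_X ^ N / alternating_exp) * alternating_exp = fps_X ^ N" by simp
  then have "fps_nth ((fps_X ^ N / alternating_exp) * alternating_exp) j = (if j = N then 1 else 0)"
    by simp
  then show ?thesis
    unfolding fps_nth_alternating_exp[symmetric] multi_bernoulli_def alternating_exp_eq[symmetric]
    by (simp add: fps_mult_nth atLeast0AtMost)
qed

text \<open>Up to factorials these sums are the coefficients of exp(x X) *
  \<open>alternating_exp\<close>, a series of order N.\<close>

lemma alternating_power_sum_eq_0:
  assumes "d < N"
  shows "(\<Sum>A\<in>Pow {1..N}. (-1) ^ (N - card A) * (x + sum \<omega> A) ^ d) = 0"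
proof -
  have "fps_exp x * alternating_exp = (\<Sum>A\<in>Pow {1..N}. (-1) ^ (N - card A) * fps_exp (x + sum \<omega> A))"
    unfolding alternating_exp_def sum_distrib_left fps_exp_add_mult by (simp add: mult_ac)
  then have "fps_nth (fps_exp x * alternating_exp) d =
      (\<Sum>A\<in>Pow {1..N}. (-1) ^ (N - card A) * (x + sum \<omega> A) ^ d) / fact d"
    by (simp add: fps_sum_nth fps_nth_signed sum_divide_distrib)
  moreover have "fps_nth (fps_exp x * alternating_exp) d = 0"
  proof -
    have "fps_nth alternating_exp i = 0" if "i \<le> d" for i
      using that assms subdegree_alternating_exp by (intro nth_less_subdegree_zero) auto
    then show ?thesis by (simp add: fps_mult_nth)
  qed
  ultimately show ?thesis by simp
qed

text \<open>The falling factorial is the factor that D^N produces from x powr (N - s): the result is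
  \<open>pole_poly s * x powr (- s)\<close>.\<close>

lemma pole_poly_eq_gchoose: "pole_poly s = fact N * ((of_nat N - s) gchoose N)"
proof -
  have "pole_poly s = (\<Prod>i<N. of_nat N - s - of_nat i)"
    unfolding pole_poly_def
    by (rule prod.reindex_bij_witness[of _ "\<lambda>i. N - i" "\<lambda>i. N - i"]) (auto simp: of_nat_diff)
  then show ?thesis by (simp add: gchoose_eq_prod)
qed

section \<open>Antidifference of a power\<close>

text \<open>
  Applying \<open>D\<^sup>-\<^sup>N \<Sum>n. B n / n! D\<^sup>n\<close> to \<open>x powr (- s)\<close> and multiplying by \<^const>\<open>pole_poly\<close> to clear
  the denominators gives the derivatives of \<open>x powr (N - s)\<close> below.  The error of this
  antidifference is studied in the variable \<open>u = 1 / x\<close>, after division by \<open>x powr (N - s)\<close>.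
\<close>

definition antidiff :: "nat \<Rightarrow> complex \<Rightarrow> complex \<Rightarrow> complex" where
  "antidiff K x s = (\<Sum>n<K. B n * ((of_nat N - s) gchoose n) * x powr (of_nat N - s - of_nat n))"

definition diff_error :: "nat \<Rightarrow> complex \<Rightarrow> complex \<Rightarrow> complex" where
  "diff_error K u s = pole_poly s * u ^ N - (\<Sum>A\<in>Pow {1..N}. (-1) ^ (N - card A) *
     (\<Sum>n<K. B n * ((of_nat N - s) gchoose n) * u ^ n *
        (1 + sum \<omega> A * u) powr (of_nat N - s - of_nat n)))"

text \<open>Trinomial revision, (\<alpha> choose n)(\<alpha> - n choose j - n) = (\<alpha> choose
  j)(j choose n), pulls the dependence on s out of the coefficient of u^j. What remains is the
  Bernoulli convolution: it is nonzero only for j = N, where it cancels \<open>pole_poly s\<close>.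
  Truncating at K leaves the coefficients below K intact.\<close>

lemma diff_error_fps:
  obtains F where "(\<lambda>u. diff_error K u s) has_fps_expansion F" "\<And>j. j < K \<Longrightarrow> fps_nth F j = 0"
proof -
  define \<alpha> where "\<alpha> = of_nat N - s"
  define F where "F = fps_const (pole_poly s) * fps_X ^ N -
     (\<Sum>A\<in>Pow {1..N}. fps_const ((-1) ^ (N - card A)) *
     (\<Sum>n<K. fps_const (B n * (\<alpha> gchoose n)) * fps_X ^ n *
        (fps_binomial (\<alpha> - of_nat n) oo (fps_const (sum \<omega> A) * fps_X))))"
  have pw: "(\<lambda>u. (1 + c * u) powr b) has_fps_expansion (fps_binomial b oo (fps_const c * fps_X))"
    for b c :: complex
  proof -
    have "((\<lambda>u. (1 + u) powr b) \<circ> (\<lambda>u. c * u)) has_fps_expansion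
            (fps_binomial b oo (fps_const c * fps_X))"
      by (intro has_fps_expansion_compose fps_expansion_intros) auto
    then show ?thesis by (simp add: o_def)
  qed
  have "(\<lambda>u. diff_error K u s) has_fps_expansion F"
    unfolding diff_error_def F_def \<alpha>_def[symmetric]
    by (intro fps_expansion_intros pw)
  moreover have "fps_nth F j = 0" if j: "j < K" for j
  proof -
    have bin: "fps_nth (fps_binomial b oo (fps_const c * fps_X)) m = c ^ m * (b gchoose m)"
      for b c :: complex and m
      by (simp add: fps_compose_linear fps_binomial_def)
    have nth: "fps_nth (fps_const c * fps_X ^ n * g) j = (if n \<le> j then c * fps_nth g (j - n) else 0)"
      for c n and g :: "complex fps"
      by (simp add: mult.assoc fps_X_power_mult_nth not_less)
    have "(\<Sum>n<K. if n \<le> j then B n * (\<alpha> gchoose n) * (c ^ (j - n) * (\<alpha> - of_nat n gchoose (j - n))) else 0)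
        = (\<Sum>n\<le>j. (\<alpha> gchoose j) * fact j * (B n / fact n * (c ^ (j - n) / fact (j - n))))" for c
    proof -
      have "(\<Sum>n<K. if n \<le> j then B n * (\<alpha> gchoose n) * (c ^ (j - n) * (\<alpha> - of_nat n gchoose (j - n))) else 0)
          = (\<Sum>n\<le>j. B n * (\<alpha> gchoose n) * (c ^ (j - n) * (\<alpha> - of_nat n gchoose (j - n))))"
        by (rule sum.mono_neutral_cong_right) (use j in auto)
      also have "\<dots> = (\<Sum>n\<le>j. (\<alpha> gchoose j) * fact j * (B n / fact n * (c ^ (j - n) / fact (j - n))))"
      proof (intro sum.cong refl)
        fix n assume "n \<in> {..j}"
        then have n: "n \<le> j" by simp
        have "(\<alpha> gchoose n) * (\<alpha> - of_nat n gchoose (j - n)) = (\<alpha> gchoose j) * (of_nat j gchoose n)"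
          using gbinomial_trinomial_revision[OF n, of \<alpha>] by simp
        also have "of_nat j gchoose n = (fact j / (fact n * fact (j - n)) :: complex)"
          using n by (simp add: binomial_gbinomial[symmetric] binomial_fact)
        finally have *: "(\<alpha> gchoose n) * (\<alpha> - of_nat n gchoose (j - n)) =
             (\<alpha> gchoose j) * (fact j / (fact n * fact (j - n)))" .
        have "B n * (\<alpha> gchoose n) * (c ^ (j - n) * (\<alpha> - of_nat n gchoose (j - n))) =
              B n * c ^ (j - n) * ((\<alpha> gchoose n) * (\<alpha> - of_nat n gchoose (j - n)))"
          by (simp add: mult_ac)
        then show "B n * (\<alpha> gchoose n) * (c ^ (j - n) * (\<alpha> - of_nat n gchoose (j - n))) =
              (\<alpha> gchoose j) * fact j * (B n / fact n * (c ^ (j - n) / fact (j - n)))"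
          unfolding * by (simp add: field_simps)
      qed
      finally show ?thesis .
    qed
    then have "fps_nth F j = fps_nth (fps_const (pole_poly s) * fps_X ^ N) j -
       (\<Sum>A\<in>Pow {1..N}. (-1) ^ (N - card A) *
         (\<Sum>n\<le>j. (\<alpha> gchoose j) * fact j * (B n / fact n * (sum \<omega> A ^ (j - n) / fact (j - n)))))"
      unfolding F_def by (simp add: fps_sum_nth nth bin cong: if_cong)
    also have "(\<Sum>A\<in>Pow {1..N}. (-1) ^ (N - card A) *
         (\<Sum>n\<le>j. (\<alpha> gchoose j) * fact j * (B n / fact n * (sum \<omega> A ^ (j - n) / fact (j - n))))) =
       (\<alpha> gchoose j) * fact j * (\<Sum>n\<le>j. B n / fact n *
          (\<Sum>A\<in>Pow {1..N}. (-1) ^ (N - card A) * (sum \<omega> A ^ (j - n) / fact (j - n))))"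
      unfolding sum_distrib_left by (subst sum.swap) (simp add: mult_ac)
    also have "\<dots> = (if j = N then pole_poly s else 0)"
      unfolding bernoulli_convolution by (simp add: pole_poly_eq_gchoose \<alpha>_def mult.commute)
    also have "fps_nth (fps_const (pole_poly s) * fps_X ^ N) j = (if j = N then pole_poly s else 0)"
      by simp
    finally show ?thesis by simp
  qed
  ultimately show ?thesis using that by blast
qed

lemma one_plus_sum_omega_pos:
  assumes "norm u \<le> 1 / (2 * omega_bound)" "A \<subseteq> {1..N}"
  shows "Re (1 + sum \<omega> A * u) > 0"
proof -
  have "norm (sum \<omega> A * u) \<le> omega_bound * (1 / (2 * omega_bound))"
    unfolding norm_mult using assms norm_sum_omega_less[OF assms(2)] omega_bound_ge_1
    by (intro mult_mono) auto
  also have "\<dots> = 1 / 2" using omega_bound_ge_1 by simp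
  finally show ?thesis
    using abs_Re_le_cmod[of "sum \<omega> A * u"] by simp
qed

lemma continuous_on_gchoose [continuous_intros]:
  fixes f :: "'a::topological_space \<Rightarrow> complex"
  shows "continuous_on S f \<Longrightarrow> continuous_on S (\<lambda>x. f x gchoose n)"
  unfolding gchoose_eq_prod by (intro continuous_intros) auto

lemma holomorphic_on_gchoose [holomorphic_intros]:
  "f holomorphic_on S \<Longrightarrow> (\<lambda>x. f x gchoose n) holomorphic_on S"
  unfolding gchoose_eq_prod by (intro holomorphic_intros) auto

lemma holomorphic_pole_poly [holomorphic_intros]: "f holomorphic_on S \<Longrightarrow> (\<lambda>x. pole_poly (f x)) holomorphic_on S"
  unfolding pole_poly_def by (intro holomorphic_intros)

lemma continuous_on_pole_poly [continuous_intros]: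
  "continuous_on S f \<Longrightarrow> continuous_on S (\<lambda>x. pole_poly (f x))"
  unfolding pole_poly_def by (intro continuous_intros)

lemma diff_error_bound:
  assumes "compact C"
  shows "\<exists>M. \<forall>s\<in>C. \<forall>u. norm u \<le> 1 / (4 * omega_bound) \<longrightarrow> norm (diff_error K u s) \<le> M * norm u ^ K"
proof -
  \<comment> \<open>Twice the radius in the claim, since the Taylor estimate holds on half the disc;
    on this larger disc the bases 1 + sum \<omega> A * u still have positive real part.\<close>
  define r where "r = 1 / (2 * omega_bound)"
  have r: "r > 0" using omega_bound_ge_1 by (simp add: r_def)
  have pos: "1 + sum \<omega> A * u \<notin> \<real>\<^sub>\<le>\<^sub>0" "1 + sum \<omega> A * u \<noteq> 0"
    if "norm u \<le> r" "A \<subseteq> {1..N}" for u A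
  proof -
    have pos: "Re (1 + sum \<omega> A * u) > 0"
      by (rule one_plus_sum_omega_pos) (use that in \<open>auto simp: r_def\<close>)
    then show "1 + sum \<omega> A * u \<notin> \<real>\<^sub>\<le>\<^sub>0" using complex_nonpos_Reals_iff[of "1 + sum \<omega> A * u"] by linarith
    show "1 + sum \<omega> A * u \<noteq> 0"
    proof
      assume "1 + sum \<omega> A * u = 0"
      with pos show False by (simp only: zero_complex.sel less_irrefl)
    qed
  qed
  have pw: "continuous_on (cball 0 r \<times> C)
        (\<lambda>p. (1 + sum \<omega> A * fst p) powr (of_nat N - snd p - of_nat n))"
    if "A \<in> Pow {1..N}" for A n
  proof -
    have A: "A \<subseteq> {1..N}" using that by auto
    have "continuous_on (cball 0 r \<times> C)
        (\<lambda>p. exp ((of_nat N - snd p - of_nat n) * Ln (1 + sum \<omega> A * fst p)))"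
      using pos(1)[OF _ A] by (auto intro!: continuous_intros)
    then show ?thesis
      by (rule continuous_on_eq) (use pos(2)[OF _ A] in \<open>auto simp: powr_def\<close>)
  qed
  have cont: "continuous_on (cball 0 r \<times> C) (\<lambda>p. diff_error K (fst p) (snd p))"
    unfolding diff_error_def
    by (intro pw continuous_on_diff continuous_on_sum continuous_on_mult continuous_on_power
        continuous_on_gchoose continuous_on_pole_poly continuous_on_const continuous_on_fst
        continuous_on_snd continuous_on_id)
  have holo: "(\<lambda>u. diff_error K u s) holomorphic_on cball 0 r" for s
    unfolding diff_error_def using pos(1) by (auto intro!: holomorphic_intros)
  have "1 / (4 * omega_bound) = r / 2" by (simp add: r_def)
  then show ?thesis
    using uniform_bound_of_vanishing_coeffs[OF r assms cont holo] diff_error_fps by metis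
qed

lemma holomorphic_diff_error:
  assumes "norm u \<le> 1 / (2 * omega_bound)"
  shows "diff_error K u holomorphic_on UNIV"
proof -
  have "1 + sum \<omega> A * u \<noteq> 0" if "A \<subseteq> {1..N}" for A
    using one_plus_sum_omega_pos[OF assms that] by (metis less_irrefl zero_complex.sel(1))
  then show ?thesis
    unfolding diff_error_def[abs_def] powr_def by (auto intro!: holomorphic_intros)
qed

lemma holomorphic_antidiff:
  assumes "x \<noteq> 0"
  shows "antidiff K x holomorphic_on S"
  unfolding antidiff_def[abs_def] powr_def using assms by (auto intro!: holomorphic_intros)

text \<open>As |sum \<omega> A| < |x|, each translated power splits on the principal branch. The
  factor x powr (N - s) comes out, and the rest is a function of 1 / x.\<close>

lemma antidiff_difference:
  assumes x: "Re x \<ge> 4 * omega_bound"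
  shows "pole_poly s * x powr (- s) - (\<Sum>A\<in>Pow {1..N}. (-1) ^ (N - card A) * antidiff K (x + sum \<omega> A) s) =
         x powr (of_nat N - s) * diff_error K (1 / x) s"
proof -
  have x0: "x \<noteq> 0" and Rex: "Re x > 0" using x omega_bound_ge_1 by auto
  have "x powr (- s) = x powr (of_nat N - s) * (1 / x) ^ N"
    using x0 powr_add[of x "- s" "of_nat N"] by (simp add: powr_nat' field_simps)
  moreover have "antidiff K (x + sum \<omega> A) s = x powr (of_nat N - s) * (\<Sum>n<K. B n * ((of_nat N - s) gchoose n)
       * (1 / x) ^ n * (1 + sum \<omega> A * (1 / x)) powr (of_nat N - s - of_nat n))"
    if "A \<in> Pow {1..N}" for A
  proof -
    have A: "A \<subseteq> {1..N}" using that by auto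
    have "norm (sum \<omega> A) < norm x"
      using norm_sum_omega_less[OF A] x omega_bound_ge_1 complex_Re_le_cmod[of x] by linarith
    then have *: "(x + sum \<omega> A) powr b = x powr b * (1 + sum \<omega> A / x) powr b" for b
      by (rule powr_add_right_half_plane[OF Rex])
    show ?thesis
      unfolding antidiff_def sum_distrib_left *
      by (intro sum.cong refl) (use x0 in \<open>simp add: powr_diff[of x _ "of_nat _"] powr_nat' power_divide mult_ac\<close>)
  qed
  ultimately show ?thesis
    unfolding diff_error_def by (simp add: algebra_simps sum_distrib_left)
qed

text \<open>At s = m the binomials vanish for n > N - m, so the antidifference becomes a polynomial
  in x of degree at most N - m < N, the kind that Delta_1 ... Delta_N annihilates.\<close>

lemma antidiff_nat:
  assumes "m \<in> {1..N}" "x \<noteq> 0" "N - m < K"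
  shows "antidiff K x (of_nat m) = (\<Sum>n\<le>N - m. B n * of_nat ((N - m) choose n) * x ^ (N - m - n))"
proof -
  have "antidiff K x (of_nat m) = (\<Sum>n<K. B n * of_nat ((N - m) choose n) * x powr (of_nat (N - m) - of_nat n))"
    unfolding antidiff_def using assms(1) by (simp add: binomial_gbinomial of_nat_diff)
  also have "\<dots> = (\<Sum>n\<le>N - m. B n * of_nat ((N - m) choose n) * x ^ (N - m - n))"
  proof (rule sum.mono_neutral_cong_right)
    fix n assume "n \<in> {..N - m}"
    then have "of_nat (N - m) - of_nat n = (of_nat (N - m - n) :: complex)"
      by (intro of_nat_diff[symmetric]) auto
    then show "B n * of_nat ((N - m) choose n) * x powr (of_nat (N - m) - of_nat n) =
          B n * of_nat ((N - m) choose n) * x ^ (N - m - n)"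
      using assms(2) by (simp only: powr_nat' simp_thms)
  qed (use assms(3) in auto)
  finally show ?thesis .
qed

lemma zeta_tail_continuation:
  assumes adm: "admissible w L (4 * omega_bound)"
  obtains Y where "Y holomorphic_on UNIV"
    "\<And>s. Re s > real N \<Longrightarrow> pole_poly s * zeta_tail w L s = Y s"
    "\<And>m. w = 0 \<Longrightarrow> m \<in> {1..N} \<Longrightarrow> Y (of_nat m) = (-1) ^ N * B (N - m)"
proof -
  define I where "I = multi_indices N"
  define T where "T = index_tail N L"
  define x where "x k = idot N k \<omega> + w" for k
  have \<rho>1: "4 * omega_bound \<ge> 1" using omega_bound_ge_1 by linarith
  have L: "L \<ge> 1" and Rex: "\<And>k. k \<in> T \<Longrightarrow> Re (x k) \<ge> 4 * omega_bound"
    using adm by (auto simp: admissible_def T_def x_def)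
  have x0: "x k \<noteq> 0" if "k \<in> T" for k using Rex[OF that] omega_bound_ge_1 by auto
  have TI: "T \<subseteq> I" by (simp add: T_def I_def index_tail_subset)
  have fin: "finite (I - T)" by (simp add: T_def I_def finite_index_complement)
  have shift_T: "index_shift N k A \<in> T" if "k \<in> T" for k A
    using that by (simp add: T_def index_shift_tail)
  have x_shift: "x (index_shift N k A) = x k + sum \<omega> A" if "A \<in> Pow {1..N}" for k A
    using that by (simp add: x_def idot_index_shift)
  have zero_notin: "(\<lambda>i\<in>{1..N}. 0) \<notin> T"
    using L by (auto simp: T_def index_tail_def index_size_def)
  define \<Delta> where "\<Delta> G k = (\<Sum>A\<in>Pow {1..N}. (-1) ^ (N - card A) * (G (index_shift N k A) :: complex))" for G k
  \<comment> \<open>Since \<open>L \<ge> 1\<close>, the cut-off function vanishes at the origin, so its telescoping sum is \<open>0\<close>.\<close>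
  define G where "G K s k = (if k \<in> T then antidiff K (x k) s else 0)" for K s k
  define E where "E K s k = x k powr (of_nat N - s) * diff_error K (1 / x k) s" for K s k
  \<comment> \<open>The telescoping sum over the whole lattice is 0, so the differences summed over
    the tail equal minus this finite sum, which is entire in s.\<close>
  define YK where "YK K s = (\<Sum>\<^sub>\<infinity>k\<in>T. E K s k) - (\<Sum>k\<in>I - T. \<Delta> (G K s) k)" for K s
  have E_eq: "E K s k = pole_poly s * x k powr (- s) - \<Delta> (G K s) k" if "k \<in> T" for K s k
    unfolding E_def antidiff_difference[OF Rex[OF that], symmetric] \<Delta>_def G_def
    using shift_T[OF that] by (simp add: x_shift)
  have series: "(\<lambda>s. \<Sum>\<^sub>\<infinity>k\<in>T. E K s k) holomorphic_on {s. real N + real N - real K < Re s}"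
    "\<And>s. real N + real N - real K < Re s \<Longrightarrow> (\<lambda>k. E K s k) summable_on T" for K
  proof -
    have h: "diff_error K u holomorphic_on UNIV" if "norm u \<le> 1 / (4 * omega_bound)" for u
    proof (rule holomorphic_diff_error)
      have "1 / (4 * omega_bound) \<le> 1 / (2 * omega_bound)"
        using omega_bound_ge_1 by (intro divide_left_mono) auto
      then show "norm u \<le> 1 / (2 * omega_bound)" using that by linarith
    qed
    show "(\<lambda>s. \<Sum>\<^sub>\<infinity>k\<in>T. E K s k) holomorphic_on {s. real N + real N - real K < Re s}"
      using lattice_series_holomorphic[OF adm \<rho>1, of 1 "diff_error K" K N, OF _ h diff_error_bound]
      by (simp add: E_def x_def T_def)
    show "(\<lambda>k. E K s k) summable_on T" if "real N + real N - real K < Re s" for s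
      using lattice_series_summable[OF adm \<rho>1, of 1 "diff_error K" K s N, OF _ h diff_error_bound] that
      by (simp add: E_def x_def T_def)
  qed
  \<comment> \<open>\<open>E\<close> has size |x| to the power N - Re s - K and the lattice has
    dimension N, hence the abscissa 2N - K.\<close>
  have YK_holo: "YK K holomorphic_on {s. Re s > real (2 * N) - real K}" for K
  proof -
    have "(\<lambda>s. G K s k) holomorphic_on X" for k X
      unfolding G_def using holomorphic_antidiff[OF x0[of k]] by (cases "k \<in> T") auto
    then have "(\<lambda>s. \<Delta> (G K s) k) holomorphic_on X" for k X
      unfolding \<Delta>_def by (intro holomorphic_intros)
    moreover have "{s. Re s > real (2 * N) - real K} = {s. real N + real N - real K < Re s}"
      by auto
    ultimately show ?thesis
      unfolding YK_def[abs_def] using series(1)[of K] by (auto intro!: holomorphic_intros)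
  qed
  \<comment> \<open>Beyond 2N even the largest term x powr (N - s) of the antidifference is
    summable, as telescoping requires.\<close>
  have YK_eq: "YK K s = pole_poly s * zeta_tail w L s" if s: "Re s > real (2 * N)" for K s
  proof -
    have pw: "(\<lambda>k. x k powr (- t)) summable_on T" if "Re t > real N" for t
      using zeta_tail_summable[OF adm \<rho>1 that] by (simp add: x_def T_def)
    have "(\<lambda>k. antidiff K (x k) s) summable_on T"
    proof -
      have "(\<lambda>k. \<Sum>n<K. B n * ((of_nat N - s) gchoose n) * x k powr (- (of_nat n + s - of_nat N)))
              summable_on T"
      proof (rule has_sum_imp_summable[OF has_sum_sum[OF has_sum_infsum]])
        fix n
        show "(\<lambda>k. B n * ((of_nat N - s) gchoose n) * x k powr (- (of_nat n + s - of_nat N)))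
                summable_on T"
          by (rule summable_on_cmult_right, rule pw) (use s in auto)
      qed
      then show ?thesis by (simp add: antidiff_def algebra_simps)
    qed
    then have "G K s summable_on I"
      by (rule summable_on_cong_neutral[THEN iffD1, rotated -1]) (use TI in \<open>auto simp: G_def\<close>)
    then have tele: "(\<Delta> (G K s) has_sum 0) I"
      using has_sum_telescope[of "G K s" N] zero_notin by (simp add: \<Delta>_def[abs_def] G_def I_def)
    then have sT: "\<Delta> (G K s) summable_on T"
      using TI by (meson summable_on_def summable_on_subset_banach)
    have "infsum (\<Delta> (G K s)) I = infsum (\<Delta> (G K s)) T + infsum (\<Delta> (G K s)) (I - T)"
    proof -
      have "I = T \<union> (I - T)" using TI by auto
      then show ?thesis
        using infsum_Un_disjoint[of "\<Delta> (G K s)" T "I - T"] sT fin by auto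
    qed
    then have "infsum (\<Delta> (G K s)) T = - (\<Sum>k\<in>I - T. \<Delta> (G K s) k)"
      using tele fin by (simp add: infsumI eq_neg_iff_add_eq_0)
    moreover have "(\<Sum>\<^sub>\<infinity>k\<in>T. E K s k + \<Delta> (G K s) k) = (\<Sum>\<^sub>\<infinity>k\<in>T. E K s k) + infsum (\<Delta> (G K s)) T"
      by (intro infsum_add series(2) sT) (use s in auto)
    moreover have "(\<Sum>\<^sub>\<infinity>k\<in>T. E K s k + \<Delta> (G K s) k) = (\<Sum>\<^sub>\<infinity>k\<in>T. pole_poly s * x k powr (- s))"
      by (intro infsum_cong) (simp add: E_eq)
    moreover have "(\<Sum>\<^sub>\<infinity>k\<in>T. pole_poly s * x k powr (- s)) = pole_poly s * zeta_tail w L s"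
      by (simp add: zeta_tail_def x_def T_def infsum_cmult_right')
    ultimately show ?thesis by (simp add: YK_def)
  qed
  obtain Y where Y: "Y holomorphic_on UNIV"
    "\<And>K s. Re s > real (2 * N) - real K \<Longrightarrow> Y s = YK K s"
    using holomorphic_glue_half_planes[of YK "real (2 * N)", OF YK_holo] YK_eq by metis
  \<comment> \<open>The identity theorem carries the equality from Re s > 2N to the full half-plane
    of convergence.\<close>
  have "pole_poly s * zeta_tail w L s = Y s" if "Re s > real N" for s
  proof (rule analytic_continuation_open[of "{s. Re s > real (2 * N)}" "{s. Re s > real N}"
          "\<lambda>s. pole_poly s * zeta_tail w L s" Y])
    show "{s. real (2 * N) < Re s} \<noteq> {}"
      by (auto intro!: exI[of _ "of_real (real (2 * N) + 1)"])
    show "connected {s. real N < Re s}"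
      by (intro convex_connected convex_halfspace_Re_gt)
    show "(\<lambda>s. pole_poly s * zeta_tail w L s) holomorphic_on {s. real N < Re s}"
      by (intro holomorphic_intros zeta_tail_holomorphic[OF adm \<rho>1])
    show "Y holomorphic_on {s. real N < Re s}" using Y(1) by (rule holomorphic_on_subset) auto
    show "pole_poly z * zeta_tail w L z = Y z" if "z \<in> {s. real (2 * N) < Re s}" for z
      using YK_eq[of z 0] Y(2)[of 0 z] that by simp
  qed (use that open_halfspace_Re_gt in auto)
  moreover have "Y (of_nat m) = (-1) ^ N * B (N - m)" if w: "w = 0" and m: "m \<in> {1..N}" for m
  proof -
    \<comment> \<open>Large enough for the half-plane Re s > 2N - K to contain every m \<ge> 1, and
      for the truncation to keep all terms of the polynomial p.\<close>
    define K where "K = 2 * N"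
    define p where "p y = (\<Sum>n\<le>N - m. B n * of_nat ((N - m) choose n) * y ^ (N - m - n))" for y
    have Qm: "pole_poly (of_nat m) = 0" unfolding pole_poly_def using m by (intro prod_zero) auto
    have NmK: "N - m < K" using m by (auto simp: K_def)
    have G_p: "G K (of_nat m) k = (if k \<in> T then p (x k) else 0)" for k
      unfolding G_def p_def using antidiff_nat[OF m x0 NmK] by auto
    have \<Delta>p: "\<Delta> (\<lambda>k. p (x k)) k = 0" for k
    proof -
      have "\<Delta> (\<lambda>k. p (x k)) k = (\<Sum>A\<in>Pow {1..N}. \<Sum>n\<le>N - m. B n * of_nat ((N - m) choose n) *
              ((-1) ^ (N - card A) * (x k + sum \<omega> A) ^ (N - m - n)))"
        unfolding \<Delta>_def p_def by (simp add: x_shift sum_distrib_left mult_ac)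
      also have "\<dots> = (\<Sum>n\<le>N - m. B n * of_nat ((N - m) choose n) *
              (\<Sum>A\<in>Pow {1..N}. (-1) ^ (N - card A) * (x k + sum \<omega> A) ^ (N - m - n)))"
        unfolding sum_distrib_left by (rule sum.swap)
      also have "\<dots> = 0"
      proof (intro sum.neutral ballI)
        fix n assume "n \<in> {..N - m}"
        have "(\<Sum>A\<in>Pow {1..N}. (-1) ^ (N - card A) * (x k + sum \<omega> A) ^ (N - m - n)) = 0"
          by (rule alternating_power_sum_eq_0) (use m in auto)
        then show "B n * of_nat ((N - m) choose n) *
            (\<Sum>A\<in>Pow {1..N}. (-1) ^ (N - card A) * (x k + sum \<omega> A) ^ (N - m - n)) = 0"
          by (simp only: mult_zero_right)
      qed
      finally show ?thesis .
    qed
    \<comment> \<open>\<open>\<Delta>\<close> annihilates p on the whole lattice. The cut-off p on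
      the tail can therefore be traded for minus its finitely supported complement \<open>H\<close>,
      whose telescoping sum is its value at the origin up to sign.\<close>
    define H where "H k = (if k \<in> I - T then p (x k) else 0)" for k
    have \<Delta>GH: "\<Delta> (G K (of_nat m)) k = - \<Delta> H k" for k
    proof -
      have "\<Delta> (G K (of_nat m)) k + \<Delta> H k = \<Delta> (\<lambda>k. p (x k)) k"
        unfolding \<Delta>_def sum.distrib[symmetric]
        by (intro sum.cong refl) (auto simp: G_p H_def I_def index_shift_in)
      then show ?thesis by (simp add: \<Delta>p eq_neg_iff_add_eq_0)
    qed
    have \<Delta>H_T: "\<Delta> H k = 0" if "k \<in> T" for k
      using shift_T[OF that] by (simp add: \<Delta>_def H_def)
    have "H summable_on I"
    proof -
      have "(\<lambda>k. p (x k)) summable_on (I - T)" using fin by (rule summable_on_finite)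
      then show ?thesis
        by (rule summable_on_cong_neutral[THEN iffD1, rotated -1]) (auto simp: H_def)
    qed
    then have "(\<Delta> H has_sum (-1) ^ N * H (\<lambda>i\<in>{1..N}. 0)) I"
      using has_sum_telescope[of H N] by (simp add: \<Delta>_def[abs_def] I_def)
    moreover have "(\<Delta> H has_sum (\<Sum>k\<in>I - T. \<Delta> H k)) I"
      by (rule has_sum_finite_neutralI) (use fin \<Delta>H_T in auto)
    ultimately have "(\<Sum>k\<in>I - T. \<Delta> H k) = (-1) ^ N * H (\<lambda>i\<in>{1..N}. 0)"
      using has_sum_unique by blast
    also have "H (\<lambda>i\<in>{1..N}. 0) = p 0"
      using zero_notin by (simp add: H_def I_def multi_indices_def x_def w idot_def)
    \<comment> \<open>By 0 ^ 0 = 1 only the constant term n = N - m survives.\<close>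
    also have "p 0 = (\<Sum>n\<in>{N - m}. B n * of_nat ((N - m) choose n) * 0 ^ (N - m - n))"
      unfolding p_def by (rule sum.mono_neutral_right) auto
    also have "\<dots> = B (N - m)" by simp
    finally have "(\<Sum>k\<in>I - T. \<Delta> H k) = (-1) ^ N * B (N - m)" .
    moreover have "(\<Sum>\<^sub>\<infinity>k\<in>T. E K (of_nat m) k) = 0"
      by (rule infsum_0) (simp add: E_eq Qm \<Delta>GH \<Delta>H_T)
    moreover have "Y (of_nat m) = YK K (of_nat m)"
      using m by (intro Y(2)) (auto simp: K_def)
    ultimately show ?thesis by (simp add: YK_def \<Delta>GH sum_negf)
  qed
  ultimately show ?thesis using that Y(1) by blast
qed

end

section \<open>Expansion of the product\<close>

text \<open>The constant coefficient is \<open>z ^ 0 / 0 = 0\<close>, as it should be for a logarithm.\<close>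

definition log_fps :: "complex \<Rightarrow> complex fps" where
  "log_fps z = Abs_fps (\<lambda>l. z ^ l / of_nat l)"

lemma log_fps_nth: "fps_nth (log_fps z) l = z ^ l / of_nat l"
  by (simp add: log_fps_def)

lemma log_fps_expansion: "(\<lambda>u. - Ln (1 - z * u)) has_fps_expansion log_fps z"
proof (rule has_fps_expansionI)
  have "eventually (\<lambda>u. norm (z * u) < 1) (nhds 0)"
  proof -
    have "open {u. norm (z * u) < 1}" by (intro open_Collect_less continuous_intros)
    then show ?thesis using eventually_nhds_in_open[of "{u. norm (z * u) < 1}" 0] by simp
  qed
  then show "eventually (\<lambda>u. (\<lambda>l. fps_nth (log_fps z) l * u ^ l) sums - Ln (1 - z * u)) (nhds 0)"
  proof eventually_elim
    case (elim u)
    have "(\<lambda>l. - ((z * u) ^ l) / of_nat l) sums Ln (1 - z * u)"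
      using Ln_series'[of "- (z * u)"] elim by simp
    from sums_minus[OF this] show ?case
      by (simp add: log_fps_nth power_mult_distrib)
  qed
qed

definition log_fps_sum :: "nat \<Rightarrow> (nat \<Rightarrow> complex) \<Rightarrow> complex fps" where
  "log_fps_sum n z = (\<Sum>j=1..n. log_fps (z j))"

definition log_sum :: "nat \<Rightarrow> (nat \<Rightarrow> complex) \<Rightarrow> complex \<Rightarrow> complex" where
  "log_sum n z u = (\<Sum>j=1..n. - Ln (1 - z j * u))"

definition pow_coeff :: "nat \<Rightarrow> (nat \<Rightarrow> complex) \<Rightarrow> nat \<Rightarrow> complex \<Rightarrow> complex" where
  "pow_coeff n z m s = (\<Sum>i=0..m. s ^ i / fact i * fps_nth (log_fps_sum n z ^ i) m)"

definition pow_coeff' :: "nat \<Rightarrow> (nat \<Rightarrow> complex) \<Rightarrow> nat \<Rightarrow> complex \<Rightarrow> complex" where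
  "pow_coeff' n z m s = (\<Sum>i=1..m. s ^ (i - 1) / fact i * fps_nth (log_fps_sum n z ^ i) m)"

text \<open>
  \<open>exp (s * log_sum n z u)\<close> is the product of the \<open>(1 - z j * u) powr (- s)\<close>, with expansion
  coefficients \<open>pow_coeff n z m s\<close>; their common zero at \<open>s = 0\<close> for \<open>m \<ge> 1\<close> is divided out
  in \<open>pow_coeff'\<close>.
\<close>

definition pow_remainder :: "nat \<Rightarrow> (nat \<Rightarrow> complex) \<Rightarrow> nat \<Rightarrow> complex \<Rightarrow> complex \<Rightarrow> complex" where
  "pow_remainder n z N u s = exp (s * log_sum n z u) - (\<Sum>m\<le>N. pow_coeff n z m s * u ^ m)"

lemma log_fps_sum_0: "fps_nth (log_fps_sum n z) 0 = 0"
  by (simp add: log_fps_sum_def fps_sum_nth log_fps_nth)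

lemma log_fps_sum_nth: "fps_nth (log_fps_sum n z) m = (\<Sum>j=1..n. z j ^ m / of_nat m)"
  by (simp add: log_fps_sum_def fps_sum_nth log_fps_nth)

lemma log_sum_expansion: "log_sum n z has_fps_expansion log_fps_sum n z"
  unfolding log_sum_def[abs_def] log_fps_sum_def
  by (intro has_fps_expansion_sum log_fps_expansion)

lemma pow_coeff_0: "pow_coeff n z 0 s = 1"
  by (simp add: pow_coeff_def)

lemma pow_coeff_eq: "m \<ge> 1 \<Longrightarrow> pow_coeff n z m s = s * pow_coeff' n z m s"
proof -
  assume m: "m \<ge> 1"
  have "pow_coeff n z m s = (\<Sum>i=1..m. s ^ i / fact i * fps_nth (log_fps_sum n z ^ i) m)"
    unfolding pow_coeff_def using m by (subst sum.atLeast_Suc_atMost) auto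
  also have "\<dots> = s * pow_coeff' n z m s"
    unfolding pow_coeff'_def sum_distrib_left
  proof (intro sum.cong refl)
    fix i assume "i \<in> {1..m}"
    then have "s ^ i = s * s ^ (i - 1)" by (cases i) auto
    then show "s ^ i / fact i * fps_nth (log_fps_sum n z ^ i) m =
       s * (s ^ (i - 1) / fact i * fps_nth (log_fps_sum n z ^ i) m)" by simp
  qed
  finally show ?thesis .
qed

text \<open>Dividing exp(s l) - 1 = s l + s^2 l^2 / 2 + ... by s leaves l at s = 0, with derivative
  l^2 / 2. Squares of logarithms enter through this derivative.\<close>

lemma pow_coeff'_at_0:
  assumes "m \<ge> 1"
  shows "pow_coeff' n z m 0 = fps_nth (log_fps_sum n z) m"
    and "(pow_coeff' n z m has_field_derivative fps_nth (log_fps_sum n z ^ 2) m / 2) (at 0)"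
proof -
  have "pow_coeff' n z m 0 = (\<Sum>i\<in>{1}. 0 ^ (i - 1) / fact i * fps_nth (log_fps_sum n z ^ i) m)"
    unfolding pow_coeff'_def by (rule sum.mono_neutral_right) (use assms in auto)
  then show "pow_coeff' n z m 0 = fps_nth (log_fps_sum n z) m" by simp
  \<comment> \<open>For m = 1 the sum ends before i = 2. This agrees with the claim because a series
    without constant term has a square without linear term.\<close>
  have sq: "fps_nth (log_fps_sum n z ^ 2) 1 = 0"
    by (simp add: power2_eq_square fps_mult_nth log_fps_sum_0)
  have "(pow_coeff' n z m has_field_derivative
      (\<Sum>i=1..m. of_nat (i - 1) * 0 ^ (i - 2) / fact i * fps_nth (log_fps_sum n z ^ i) m)) (at 0)"
    unfolding pow_coeff'_def[abs_def]
    by (auto intro!: derivative_eq_intros sum.cong simp: numeral_2_eq_2)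
  also have "(\<Sum>i=1..m. of_nat (i - 1) * 0 ^ (i - 2) / fact i * fps_nth (log_fps_sum n z ^ i) m) =
      (\<Sum>i\<in>{1..m} \<inter> {2}. of_nat (i - 1) * 0 ^ (i - 2) / fact i * fps_nth (log_fps_sum n z ^ i) m)"
    by (rule sum.mono_neutral_right) (auto simp: not_le)
  also have "\<dots> = fps_nth (log_fps_sum n z ^ 2) m / 2"
    using assms sq by (cases "m = 1") (auto simp: numeral_2_eq_2)
  finally show "(pow_coeff' n z m has_field_derivative fps_nth (log_fps_sum n z ^ 2) m / 2) (at 0)" .
qed

text \<open>As \<open>log_fps_sum\<close> has no constant term, its i-th power has order at least i.
  The finite sum in \<open>pow_coeff\<close> is thus the full coefficient of the
  exponential.\<close>

lemma pow_remainder_fps: "\<exists>F. (\<lambda>u. pow_remainder n z N u s) has_fps_expansion F \<and> (\<forall>j<Suc N. fps_nth F j = 0)"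
proof -
  define F where "F = (fps_exp s oo log_fps_sum n z) - (\<Sum>m\<le>N. fps_const (pow_coeff n z m s) * fps_X ^ m)"
  have "((\<lambda>u. exp (s * u)) \<circ> log_sum n z) has_fps_expansion (fps_exp s oo log_fps_sum n z)"
    by (intro has_fps_expansion_compose log_sum_expansion fps_expansion_intros log_fps_sum_0)
  then have "(\<lambda>u. exp (s * log_sum n z u)) has_fps_expansion (fps_exp s oo log_fps_sum n z)"
    by (simp add: o_def)
  then have "(\<lambda>u. pow_remainder n z N u s) has_fps_expansion F"
    unfolding pow_remainder_def F_def by (intro fps_expansion_intros)
  moreover have "fps_nth F j = 0" if "j < Suc N" for j
  proof -
    have "fps_nth (\<Sum>m\<le>N. fps_const (pow_coeff n z m s) * fps_X ^ m) j =
        (\<Sum>m\<le>N. if m = j then pow_coeff n z m s else 0)"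
      unfolding fps_sum_nth by (rule sum.cong) auto
    also have "\<dots> = pow_coeff n z j s"
      using that by simp
    finally show ?thesis
      by (simp add: F_def fps_compose_nth pow_coeff_def)
  qed
  ultimately show ?thesis by blast
qed

text \<open>The disc has twice the radius 1 / \<rho> on which remainders are used, again to pay for
  the Taylor estimate; the factor 4 keeps |z u| below 1/2 there.\<close>

lemma one_minus_pos:
  fixes z u :: complex
  assumes \<rho>: "4 * (1 + norm z) \<le> \<rho>" and u: "norm u \<le> 2 / \<rho>"
  shows "Re (1 - z * u) > 0"
proof -
  have "0 < 4 * (1 + norm z)" by (simp add: add_pos_nonneg)
  then have \<rho>0: "\<rho> > 0" using \<rho> by (rule less_le_trans)
  have "norm (z * u) \<le> norm z * (2 / \<rho>)"
    unfolding norm_mult using u by (intro mult_left_mono) auto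
  also have "\<dots> < 1" using \<rho> \<rho>0 by (simp add: field_simps)
  finally show ?thesis using complex_Re_le_cmod[of "z * u"] by simp
qed

lemma holomorphic_pow_coeff [holomorphic_intros]:
  "f holomorphic_on S \<Longrightarrow> (\<lambda>x. pow_coeff n z m (f x)) holomorphic_on S"
  unfolding pow_coeff_def by (intro holomorphic_intros) auto

lemma holomorphic_pow_coeff' [holomorphic_intros]:
  "f holomorphic_on S \<Longrightarrow> (\<lambda>x. pow_coeff' n z m (f x)) holomorphic_on S"
  unfolding pow_coeff'_def by (intro holomorphic_intros) auto

lemma pow_remainder_bound:
  assumes \<rho>: "\<rho> \<ge> 1" "\<And>j. j \<in> {1..n} \<Longrightarrow> 4 * (1 + norm (z j)) \<le> \<rho>" and C: "compact C"
  shows "\<exists>M. \<forall>s\<in>C. \<forall>u. norm u \<le> 1 / \<rho> \<longrightarrow> norm (pow_remainder n z N u s) \<le> M * norm u ^ Suc N"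
proof -
  have r: "2 / \<rho> > 0" using \<rho> by simp
  have pos: "1 - z j * u \<notin> \<real>\<^sub>\<le>\<^sub>0" if "j \<in> {1..n}" "norm u \<le> 2 / \<rho>" for j u
    using one_minus_pos[OF \<rho>(2)[OF that(1)] that(2)] complex_nonpos_Reals_iff[of "1 - z j * u"] by linarith
  have "continuous_on (cball 0 (2 / \<rho>) \<times> C) (\<lambda>p. pow_coeff n z m (snd p))" for m
    unfolding pow_coeff_def by (intro continuous_intros) auto
  then have "continuous_on (cball 0 (2 / \<rho>) \<times> C) (\<lambda>p. pow_remainder n z N (fst p) (snd p))"
    unfolding pow_remainder_def log_sum_def using pos by (auto intro!: continuous_intros)
  moreover have "(\<lambda>u. pow_remainder n z N u s) holomorphic_on cball 0 (2 / \<rho>)" for s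
    unfolding pow_remainder_def log_sum_def using pos by (auto intro!: holomorphic_intros)
  ultimately have "\<exists>M. \<forall>s\<in>C. \<forall>u. norm u \<le> (2 / \<rho>) / 2 \<longrightarrow> norm (pow_remainder n z N u s) \<le> M * norm u ^ Suc N"
    by (intro uniform_bound_of_vanishing_coeffs[OF r C] pow_remainder_fps)
  then show ?thesis by simp
qed

lemma prod_powr_diff:
  fixes x :: complex
  assumes x: "Re x > 0" and z: "\<And>j. j \<in> {1..n} \<Longrightarrow> norm (z j) < norm x"
  shows "(\<Prod>j=1..n. (x - z j) powr (- s)) = x powr (- (of_nat n * s)) * exp (s * log_sum n z (1 / x))"
proof -
  have x0: "x \<noteq> 0" using x by auto
  have "(x - z j) powr (- s) = x powr (- s) * exp (s * (- Ln (1 - z j * (1 / x))))" if "j \<in> {1..n}" for j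
  proof -
    have "(x + - z j) powr (- s) = x powr (- s) * (1 + - z j / x) powr (- s)"
      by (rule powr_add_right_half_plane[OF x]) (use z[OF that] in simp)
    moreover have "1 - z j / x \<noteq> 0" using z[OF that] x0 by auto
    ultimately show ?thesis by (simp add: powr_def)
  qed
  then have "(\<Prod>j=1..n. (x - z j) powr (- s)) = (\<Prod>j=1..n. x powr (- s) * exp (s * (- Ln (1 - z j * (1 / x)))))"
    by (intro prod.cong refl)
  also have "\<dots> = (x powr (- s)) ^ n * exp (s * log_sum n z (1 / x))"
    by (simp add: prod.distrib exp_sum[symmetric] log_sum_def sum_distrib_left)
  also have "(x powr (- s)) ^ n = x powr (- (of_nat n * s))"
    using x0 by (simp add: powr_def exp_of_nat_mult[symmetric] mult_ac)
  finally show ?thesis .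
qed

section \<open>The product series near s = 0\<close>

context barnes_lattice
begin

text \<open>Removing the Taylor terms up to degree N makes the sum over the N-dimensional lattice
  converge, as in the exponents of Weierstrass elementary factors.\<close>

definition log_remainder :: "complex \<Rightarrow> complex \<Rightarrow> complex" where
  "log_remainder z u = - Ln (1 - z * u) - (\<Sum>m=1..N. z ^ m / of_nat m * u ^ m)"

text \<open>To first order in s the exponential is 1 plus s times a sum of logarithms, which makes
  the derivative additive in the z j.\<close>

lemma pow_remainder_deriv_0: "((\<lambda>s. pow_remainder n z N u s) has_field_derivative (\<Sum>j=1..n. log_remainder (z j) u)) (at 0)"
    and pow_remainder_0: "pow_remainder n z N u 0 = 0"
proof -
  have split: "(\<Sum>m\<le>N. pow_coeff n z m s * u ^ m) = 1 + (\<Sum>m=1..N. s * pow_coeff' n z m s * u ^ m)" for s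
  proof -
    have "(\<Sum>m\<le>N. pow_coeff n z m s * u ^ m) = pow_coeff n z 0 s * u ^ 0 + (\<Sum>m=1..N. pow_coeff n z m s * u ^ m)"
      unfolding atMost_atLeast0 by (subst sum.atLeast_Suc_atMost) auto
    then show ?thesis by (simp add: pow_coeff_0 pow_coeff_eq)
  qed
  show "pow_remainder n z N u 0 = 0" by (simp add: pow_remainder_def split)
  have "((\<lambda>s. pow_remainder n z N u s) has_field_derivative
      log_sum n z u - (\<Sum>m=1..N. pow_coeff' n z m 0 * u ^ m)) (at 0)"
    unfolding pow_remainder_def split
  proof -
    have "((\<lambda>s. s * pow_coeff' n z m s * u ^ m) has_field_derivative pow_coeff' n z m 0 * u ^ m) (at 0)"
      if "m \<in> {1..N}" for m
      using that by (auto intro!: derivative_eq_intros pow_coeff'_at_0(2))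
    then have "((\<lambda>s. \<Sum>m=1..N. s * pow_coeff' n z m s * u ^ m) has_field_derivative
        (\<Sum>m=1..N. pow_coeff' n z m 0 * u ^ m)) (at 0)"
      by (intro DERIV_sum) auto
    note sum = DERIV_add[OF DERIV_const[of 1] this]
    have "((\<lambda>s. exp (s * log_sum n z u)) has_field_derivative log_sum n z u) (at 0)"
      by (auto intro!: derivative_eq_intros)
    from DERIV_diff[OF this sum] show "((\<lambda>s. exp (s * log_sum n z u) - (1 + (\<Sum>m=1..N. s * pow_coeff' n z m s * u ^ m)))
        has_field_derivative log_sum n z u - (\<Sum>m=1..N. pow_coeff' n z m 0 * u ^ m)) (at 0)"
      by simp
  qed
  also have "log_sum n z u - (\<Sum>m=1..N. pow_coeff' n z m 0 * u ^ m) = (\<Sum>j=1..n. log_remainder (z j) u)"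
  proof -
    have "(\<Sum>m=1..N. pow_coeff' n z m 0 * u ^ m) = (\<Sum>m=1..N. (\<Sum>j=1..n. z j ^ m / of_nat m) * u ^ m)"
      by (intro sum.cong refl) (simp add: pow_coeff'_at_0 log_fps_sum_nth)
    also have "\<dots> = (\<Sum>j=1..n. \<Sum>m=1..N. z j ^ m / of_nat m * u ^ m)"
      unfolding sum_distrib_right by (rule sum.swap)
    finally show ?thesis by (simp add: log_sum_def log_remainder_def sum_subtractf)
  qed
  finally show "((\<lambda>s. pow_remainder n z N u s) has_field_derivative (\<Sum>j=1..n. log_remainder (z j) u)) (at 0)" .
qed

lemma holomorphic_pow_remainder: "pow_remainder n z N u holomorphic_on S"
  unfolding pow_remainder_def[abs_def] by (intro holomorphic_intros)

text \<open>A remainder of order N + 1 gives terms of size |x| to the power -n Re s - N - 1. They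
  are summable for Re s > -1 / n, a region containing 0.\<close>

lemma
  fixes n L :: nat and z :: "nat \<Rightarrow> complex"
  defines "g \<equiv> \<lambda>k s. idot N k \<omega> powr (- (of_nat n * s)) * pow_remainder n z N (1 / idot N k \<omega>) s"
  assumes adm: "admissible 0 L \<rho>" and \<rho>: "\<rho> \<ge> 1" and n: "n \<ge> 1"
    and z: "\<And>j. j \<in> {1..n} \<Longrightarrow> 4 * (1 + norm (z j)) \<le> \<rho>"
  shows pow_remainder_series_summable: "\<And>s. Re s > - 1 / real n \<Longrightarrow> (\<lambda>k. g k s) summable_on index_tail N L"
    and pow_remainder_series_holomorphic:
      "(\<lambda>s. \<Sum>\<^sub>\<infinity>k\<in>index_tail N L. g k s) holomorphic_on {s. Re s > - 1 / real n}"
    and pow_remainder_series_deriv: "((\<lambda>k. \<Sum>j=1..n. log_remainder (z j) (1 / idot N k \<omega>)) has_sum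
       deriv (\<lambda>s. \<Sum>\<^sub>\<infinity>k\<in>index_tail N L. g k s) 0) (index_tail N L)"
proof -
  have b: "\<exists>M. \<forall>s\<in>C. \<forall>u. norm u \<le> 1 / \<rho> \<longrightarrow> norm (pow_remainder n z N u s) \<le> M * norm u ^ Suc N"
    if "compact C" for C
    by (rule pow_remainder_bound[OF \<rho> z that])
  have region: "(- 1 / real n < Re s) = (real N + real 0 - real (Suc N) < real n * Re s)" for s
    using n by (simp add: field_simps)
  have g: "g = (\<lambda>k s. (idot N k \<omega> + 0) powr (of_nat 0 - of_nat n * s) * pow_remainder n z N (1 / (idot N k \<omega> + 0)) s)"
    by (simp add: g_def)
  show "(\<lambda>k. g k s) summable_on index_tail N L" if "Re s > - 1 / real n" for s
    using lattice_series_summable[OF adm \<rho> n holomorphic_pow_remainder b, of s 0] that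
    unfolding g region by blast
  show "(\<lambda>s. \<Sum>\<^sub>\<infinity>k\<in>index_tail N L. g k s) holomorphic_on {s. Re s > - 1 / real n}"
    using lattice_series_holomorphic[OF adm \<rho> n holomorphic_pow_remainder b, of 0]
    unfolding g region by blast
  have "((\<lambda>k. deriv (g k) 0) has_sum deriv (\<lambda>s. \<Sum>\<^sub>\<infinity>k\<in>index_tail N L. g k s) 0) (index_tail N L)"
    using lattice_series_deriv[OF adm \<rho> n holomorphic_pow_remainder b, of 0 0]
    unfolding g by simp
  moreover have "deriv (g k) 0 = (\<Sum>j=1..n. log_remainder (z j) (1 / idot N k \<omega>))"
    if "k \<in> index_tail N L" for k
  proof -
    have "Re (idot N k \<omega>) \<ge> 1" using adm that \<rho> by (auto simp: admissible_def)
    then have x0: "idot N k \<omega> \<noteq> 0" by auto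
    \<comment> \<open>The remainder vanishes at s = 0, so of the power in front only its value 1
      enters the product rule.\<close>
    have "(g k has_field_derivative (\<Sum>j=1..n. log_remainder (z j) (1 / idot N k \<omega>))) (at 0)"
      unfolding g_def powr_def using x0
      by (auto intro!: derivative_eq_intros pow_remainder_deriv_0 simp: pow_remainder_0)
    then show ?thesis by (rule DERIV_imp_deriv)
  qed
  ultimately show "((\<lambda>k. \<Sum>j=1..n. log_remainder (z j) (1 / idot N k \<omega>)) has_sum
       deriv (\<lambda>s. \<Sum>\<^sub>\<infinity>k\<in>index_tail N L. g k s) 0) (index_tail N L)"
    by (rule has_sum_cong[THEN iffD1, rotated]) auto
qed

text \<open>
  \<open>polar_factor Y m x\<close> is \<open>x * zeta_tail 0 L (x + m)\<close>, so its value at \<open>0\<close> is the residue at \<open>m\<close>.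
  The derivative at \<open>0\<close> of the continued product series splits into the values \<open>log_part L Y (z j)\<close>
  and a part that is quadratic in the logarithms.
\<close>

definition polar_factor :: "(complex \<Rightarrow> complex) \<Rightarrow> nat \<Rightarrow> complex \<Rightarrow> complex" where
  "polar_factor Y m x = - Y (x + of_nat m) / (\<Prod>i\<in>{1..N} - {m}. of_nat i - of_nat m - x)"

definition log_part :: "nat \<Rightarrow> (complex \<Rightarrow> complex) \<Rightarrow> complex \<Rightarrow> complex" where
  "log_part L Y z = (\<Sum>k\<in>multi_indices N - index_tail N L. - Ln (idot N k \<omega> - z)) +
     deriv (\<lambda>x. Y x / pole_poly x) 0 + (\<Sum>m=1..N. z ^ m / of_nat m * deriv (polar_factor Y m) 0) +
     (\<Sum>\<^sub>\<infinity>k\<in>index_tail N L. log_remainder z (1 / idot N k \<omega>))"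

lemma pole_poly_shift:
  assumes "m \<in> {1..N}"
  shows "pole_poly (x + of_nat m) = - x * (\<Prod>i\<in>{1..N} - {m}. of_nat i - of_nat m - x)"
  unfolding pole_poly_def by (subst prod.remove[of _ m]) (use assms in \<open>auto simp: algebra_simps\<close>)

lemma pole_poly_nonzero: "Re s > real N \<Longrightarrow> pole_poly s \<noteq> 0"
  unfolding pole_poly_def by (subst prod_zero_iff) (auto simp: algebra_simps)

lemma pole_poly_0: "pole_poly 0 \<noteq> 0"
  unfolding pole_poly_def by auto

lemma admissible_mono: "admissible w L \<rho> \<Longrightarrow> \<rho>' \<le> \<rho> \<Longrightarrow> admissible w L \<rho>'"
  unfolding admissible_def by (meson order_trans)

lemma analytic_polar_factor:
  assumes "Y holomorphic_on UNIV"
  shows "polar_factor Y m analytic_on {0}"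
proof -
  have "(\<lambda>x. Y (x + of_nat m)) analytic_on {0}"
    by (intro holomorphic_on_imp_analytic_at[of _ UNIV])
       (auto intro!: holomorphic_on_compose_entire[OF assms] holomorphic_intros)
  then show ?thesis
    unfolding polar_factor_def[abs_def] by (intro analytic_intros) auto
qed

lemma meromorphic_polar_factor:
  assumes "Y holomorphic_on UNIV"
  shows "(\<lambda>s. polar_factor Y m (of_nat n * s)) meromorphic_on X"
proof -
  have "(\<lambda>x. Y (of_nat n * x + of_nat m)) analytic_on UNIV"
    by (subst analytic_on_open) (auto intro!: holomorphic_on_compose_entire[OF assms] holomorphic_intros)
  then have "(\<lambda>x. Y (of_nat n * x + of_nat m)) meromorphic_on X"
    by (meson analytic_on_imp_meromorphic_on meromorphic_on_subset subset_UNIV)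
  then show ?thesis
    unfolding polar_factor_def by (intro meromorphic_intros)
qed

text \<open>\<open>L\<close> and \<open>Y\<close> are given instead of being constructed inside, so
  that one pair can serve both the n factors together and each factor alone.\<close>

lemma regularized_continuation:
  fixes n L :: nat and z :: "nat \<Rightarrow> complex"
  defines "T \<equiv> index_tail N L"
  assumes adm: "admissible 0 L \<rho>" and \<rho>: "\<rho> \<ge> 4 * omega_bound" and n: "n \<ge> 1"
    and z: "\<And>j. j \<in> {1..n} \<Longrightarrow> 4 * (1 + norm (z j)) \<le> \<rho>"
    and nz: "\<And>j k. j \<in> {1..n} \<Longrightarrow> k \<in> multi_indices N \<Longrightarrow> z j \<noteq> idot N k \<omega>"
    and Y: "Y holomorphic_on UNIV" "\<And>s. Re s > real N \<Longrightarrow> pole_poly s * zeta_tail 0 L s = Y s"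
  shows "\<exists>Z. Z meromorphic_on {s. Re s > - 1 / real n} \<and> Z analytic_on {0} \<and>
    (\<forall>s. Re s > real N / real n \<longrightarrow>
       Z s = (\<Sum>\<^sub>\<infinity>k\<in>multi_indices N. \<Prod>j=1..n. (idot N k \<omega> - z j) powr (- s))) \<and>
    deriv Z 0 = (\<Sum>j=1..n. log_part L Y (z j)) +
      1 / of_nat n * (\<Sum>m=1..N. polar_factor Y m 0 * fps_nth (log_fps_sum n z ^ 2) m / 2)"
proof -
  define I where "I = multi_indices N"
  have \<rho>1: "\<rho> \<ge> 1" using \<rho> omega_bound_ge_1 by linarith
  have TI: "T \<subseteq> I" by (simp add: T_def I_def index_tail_subset)
  have fin: "finite (I - T)" by (simp add: T_def I_def finite_index_complement)
  define f where "f k s = (\<Prod>j=1..n. (idot N k \<omega> - z j) powr (- s))" for k s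
  define r where "r s = (\<Sum>\<^sub>\<infinity>k\<in>T. idot N k \<omega> powr (- (of_nat n * s)) * pow_remainder n z N (1 / idot N k \<omega>) s)" for s
  \<comment> \<open>For m \<ge> 1 the factor s of \<open>pow_coeff\<close> absorbs the pole: s times
    the tail zeta function at n s + m is \<open>polar_factor Y m (of_nat n * s)\<close> divided by
    n, which is regular at 0.\<close>
  define Z where "Z s = (\<Sum>k\<in>I - T. f k s) + Y (of_nat n * s) / pole_poly (of_nat n * s) +
      (\<Sum>m=1..N. 1 / of_nat n * (pow_coeff' n z m s * polar_factor Y m (of_nat n * s))) + r s" for s
  note pow_remainder_facts = pow_remainder_series_summable[OF adm \<rho>1 n z] pow_remainder_series_holomorphic[OF adm \<rho>1 n z]
    pow_remainder_series_deriv[OF adm \<rho>1 n z]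
  have op: "open {s. Re s > - 1 / real n}" by (rule open_halfspace_Re_gt)
  have in0: "(0::complex) \<in> {s. Re s > - 1 / real n}" using n by simp

  have f_exp: "f k s = exp (s * (\<Sum>j=1..n. - Ln (idot N k \<omega> - z j)))" if "k \<in> I" for k s
  proof -
    have ne: "idot N k \<omega> \<noteq> z j" if "j \<in> {1..n}" for j
      using nz[OF that, of k] \<open>k \<in> I\<close> unfolding I_def by metis
    have "f k s = (\<Prod>j=1..n. exp (s * (- Ln (idot N k \<omega> - z j))))"
      unfolding f_def using ne by (intro prod.cong refl) (simp add: powr_def)
    then show ?thesis by (simp add: exp_sum[symmetric] sum_distrib_left)
  qed
  have f_holo: "f k holomorphic_on X" if "k \<in> I" for k X
    using f_exp[OF that] by (auto intro!: holomorphic_intros simp: fun_eq_iff[of "f k"] cong: holomorphic_cong)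
  have r_holo: "r holomorphic_on {s. Re s > - 1 / real n}"
    using pow_remainder_facts(2) by (simp add: r_def[abs_def] T_def)
  have Yn: "(\<lambda>s. Y (of_nat n * s)) holomorphic_on UNIV"
    by (intro holomorphic_on_compose_entire[OF Y(1)] holomorphic_intros)
  have Qn: "(\<lambda>s. pole_poly (of_nat n * s)) holomorphic_on UNIV" by (intro holomorphic_intros)
  have ana: "g analytic_on X" if "g holomorphic_on UNIV" for g :: "complex \<Rightarrow> complex" and X
    using that by (meson analytic_on_open analytic_on_subset open_UNIV subset_UNIV)
  have mer: "Z meromorphic_on {s. Re s > - 1 / real n}"
    unfolding Z_def[abs_def]
  proof (intro meromorphic_intros)
    show "r meromorphic_on {s. Re s > - 1 / real n}"
      using r_holo op by (simp add: analytic_on_imp_meromorphic_on analytic_on_open)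
    show "f k meromorphic_on {s. Re s > - 1 / real n}" if "k \<in> I - T" for k
      using that by (intro analytic_on_imp_meromorphic_on ana f_holo) auto
    show "(\<lambda>s. Y (of_nat n * s)) meromorphic_on {s. Re s > - 1 / real n}"
      by (intro analytic_on_imp_meromorphic_on ana Yn)
    show "(\<lambda>s. pole_poly (of_nat n * s)) meromorphic_on {s. Re s > - 1 / real n}"
      by (intro analytic_on_imp_meromorphic_on ana Qn)
    show "pow_coeff' n z m meromorphic_on {s. Re s > - 1 / real n}" for m
      by (intro analytic_on_imp_meromorphic_on ana holomorphic_intros)
  qed (use meromorphic_polar_factor[OF Y(1)] in auto)

  have polar_factor_deriv: "((\<lambda>s. polar_factor Y m (of_nat n * s)) has_field_derivative deriv (polar_factor Y m) 0 * of_nat n) (at 0)" for m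
  proof (rule DERIV_chain2[where f = "polar_factor Y m"])
    show "(polar_factor Y m has_field_derivative deriv (polar_factor Y m) 0) (at (of_nat n * 0))"
      using analytic_on_imp_differentiable_at[OF analytic_polar_factor[OF Y(1)]]
      by (simp add: DERIV_deriv_iff_field_differentiable)
  qed (auto intro!: derivative_eq_intros)
  have YQ_ana: "(\<lambda>x. Y x / pole_poly x) analytic_on {0}"
    using pole_poly_0 by (intro analytic_on_divide ana Y(1) holomorphic_intros) auto
  have YQ_deriv: "((\<lambda>s. Y (of_nat n * s) / pole_poly (of_nat n * s)) has_field_derivative
      deriv (\<lambda>x. Y x / pole_poly x) 0 * of_nat n) (at 0)"
  proof (rule DERIV_chain2[where f = "\<lambda>x. Y x / pole_poly x"])
    show "((\<lambda>x. Y x / pole_poly x) has_field_derivative deriv (\<lambda>x. Y x / pole_poly x) 0) (at (of_nat n * 0))"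
      using analytic_on_imp_differentiable_at[OF YQ_ana]
      by (simp add: DERIV_deriv_iff_field_differentiable)
  qed (auto intro!: derivative_eq_intros)
  have f_deriv: "(f k has_field_derivative (\<Sum>j=1..n. - Ln (idot N k \<omega> - z j))) (at 0)" if "k \<in> I" for k
    unfolding f_exp[OF that, abs_def] by (auto intro!: derivative_eq_intros)
  have r_deriv: "(r has_field_derivative deriv r 0) (at 0)"
    using holomorphic_on_imp_differentiable_at[OF r_holo op in0]
    by (simp add: DERIV_deriv_iff_field_differentiable)
  \<comment> \<open>The chain rule yields a factor n that cancels 1 / n next to
    \<open>deriv (polar_factor Y m) 0\<close>; the summand with the squared logarithms keeps 1 /
    n.\<close>
  have coeff_deriv: "((\<lambda>s. 1 / of_nat n * (pow_coeff' n z m s * polar_factor Y m (of_nat n * s))) has_field_derivative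
      1 / of_nat n * (polar_factor Y m 0 * fps_nth (log_fps_sum n z ^ 2) m / 2) +
      fps_nth (log_fps_sum n z) m * deriv (polar_factor Y m) 0) (at 0)" if m: "m \<in> {1..N}" for m
  proof -
    have m1: "m \<ge> 1" using m by simp
    have "((\<lambda>s. 1 / of_nat n * (pow_coeff' n z m s * polar_factor Y m (of_nat n * s))) has_field_derivative
       1 / of_nat n * (fps_nth (log_fps_sum n z ^ 2) m / 2 * polar_factor Y m (of_nat n * 0) +
          deriv (polar_factor Y m) 0 * of_nat n * pow_coeff' n z m 0)) (at 0)"
      by (intro DERIV_cmult DERIV_mult pow_coeff'_at_0(2) m1 polar_factor_deriv)
    then show ?thesis
      using n by (simp add: pow_coeff'_at_0(1)[OF m1] field_simps)
  qed
  have Z_deriv: "(Z has_field_derivative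
      (\<Sum>k\<in>I - T. \<Sum>j=1..n. - Ln (idot N k \<omega> - z j)) + deriv (\<lambda>x. Y x / pole_poly x) 0 * of_nat n +
      (\<Sum>m=1..N. 1 / of_nat n * (polar_factor Y m 0 * fps_nth (log_fps_sum n z ^ 2) m / 2) +
          fps_nth (log_fps_sum n z) m * deriv (polar_factor Y m) 0) + deriv r 0) (at 0)"
    unfolding Z_def[abs_def]
    by (intro DERIV_add DERIV_sum f_deriv YQ_deriv coeff_deriv r_deriv) auto

  \<comment> \<open>The n-fold lemma yields summability of the sum of the remainders; its case n = 1
    yields that of each one, so the sum may be split.\<close>
  have rem1: "(\<lambda>k. log_remainder (z j) (1 / idot N k \<omega>)) summable_on T" if "j \<in> {1..n}" for j
    using pow_remainder_series_deriv[OF adm \<rho>1, of 1 "\<lambda>_. z j"] z[OF that] has_sum_imp_summable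
    by (simp add: T_def)
  have "deriv r 0 = (\<Sum>j=1..n. \<Sum>\<^sub>\<infinity>k\<in>T. log_remainder (z j) (1 / idot N k \<omega>))"
  proof (rule has_sum_unique)
    show "((\<lambda>k. \<Sum>j=1..n. log_remainder (z j) (1 / idot N k \<omega>)) has_sum deriv r 0) T"
      using pow_remainder_facts(3) by (simp add: r_def[abs_def] T_def)
    show "((\<lambda>k. \<Sum>j=1..n. log_remainder (z j) (1 / idot N k \<omega>)) has_sum
       (\<Sum>j=1..n. \<Sum>\<^sub>\<infinity>k\<in>T. log_remainder (z j) (1 / idot N k \<omega>))) T"
      by (intro has_sum_sum has_sum_infsum rem1)
  qed
  moreover have "(\<Sum>k\<in>I - T. \<Sum>j=1..n. - Ln (idot N k \<omega> - z j)) =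
      (\<Sum>j=1..n. \<Sum>k\<in>I - T. - Ln (idot N k \<omega> - z j))"
    by (rule sum.swap)
  moreover have "(\<Sum>m=1..N. fps_nth (log_fps_sum n z) m * deriv (polar_factor Y m) 0) =
      (\<Sum>j=1..n. \<Sum>m=1..N. z j ^ m / of_nat m * deriv (polar_factor Y m) 0)"
    unfolding log_fps_sum_nth sum_distrib_right by (rule sum.swap)
  \<comment> \<open>The chain rule factor n of the m = 0 term is spent as one copy of
    \<open>deriv (\<lambda>x. Y x / pole_poly x) 0\<close> in each
    \<open>log_part L Y (z j)\<close>.\<close>
  ultimately have deriv: "deriv Z 0 = (\<Sum>j=1..n. log_part L Y (z j)) +
      1 / of_nat n * (\<Sum>m=1..N. polar_factor Y m 0 * fps_nth (log_fps_sum n z ^ 2) m / 2)"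
    unfolding DERIV_imp_deriv[OF Z_deriv] log_part_def
    by (simp add: sum.distrib T_def I_def sum_distrib_left mult.commute)

  have Z_ana: "Z analytic_on {0}"
    unfolding Z_def[abs_def]
  proof (intro analytic_on_add analytic_on_sum analytic_on_mult)
    show "f k analytic_on {0}" if "k \<in> I - T" for k using that by (intro ana f_holo) auto
    show "(\<lambda>s. Y (of_nat n * s) / pole_poly (of_nat n * s)) analytic_on {0}"
      using pole_poly_0 by (intro analytic_on_divide ana Yn Qn) auto
    show "r analytic_on {0}"
      using r_holo op in0 by (rule holomorphic_on_imp_analytic_at)
    show "pow_coeff' n z m analytic_on {0}" for m by (intro ana holomorphic_intros)
    show "(\<lambda>s. polar_factor Y m (of_nat n * s)) analytic_on {0}" for m
      using analytic_on_compose[of "\<lambda>s. of_nat n * s" "{0}" "polar_factor Y m"] analytic_polar_factor[OF Y(1)]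
      by (auto simp: o_def intro!: analytic_intros)
  qed auto

  have "Z s = infsum (\<lambda>k. f k s) I" if s: "Re s > real N / real n" for s
  proof -
    have ns: "real n * Re s > real N" using s n by (simp add: field_simps)
    have s0: "s \<noteq> 0" using ns by auto
    have s1: "Re s > - 1 / real n"
      using s n by (smt (verit) divide_nonneg_nonneg divide_nonpos_nonneg of_nat_0_le_iff)
    have f_tail: "f k s = (\<Sum>m\<le>N. pow_coeff n z m s * (idot N k \<omega> + 0) powr (- (of_nat n * s + of_nat m))) +
        idot N k \<omega> powr (- (of_nat n * s)) * pow_remainder n z N (1 / idot N k \<omega>) s" if k: "k \<in> T" for k
    proof -
      define x where "x = idot N k \<omega>"
      have x: "Re x \<ge> \<rho>" using adm k by (auto simp: admissible_def T_def x_def)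
      then have xp: "Re x > 0" "x \<noteq> 0" using \<rho>1 by auto
      have zx: "norm (z j) < norm x" if "j \<in> {1..n}" for j
      proof -
        have "norm (z j) < 4 * (1 + norm (z j))" by (simp add: add_nonneg_pos)
        also have "\<dots> \<le> \<rho>" by (rule z[OF that])
        also have "\<rho> \<le> norm x" using x complex_Re_le_cmod[of x] by linarith
        finally show ?thesis .
      qed
      have "f k s = x powr (- (of_nat n * s)) * exp (s * log_sum n z (1 / x))"
        unfolding f_def x_def[symmetric] by (rule prod_powr_diff[OF xp(1) zx])
      also have "exp (s * log_sum n z (1 / x)) = (\<Sum>m\<le>N. pow_coeff n z m s * (1 / x) ^ m) + pow_remainder n z N (1 / x) s"
        by (simp add: pow_remainder_def)
      also have "x powr (- (of_nat n * s)) * ((\<Sum>m\<le>N. pow_coeff n z m s * (1 / x) ^ m) + pow_remainder n z N (1 / x) s) =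
         (\<Sum>m\<le>N. pow_coeff n z m s * (x powr (- (of_nat n * s)) * (1 / x) ^ m)) +
           x powr (- (of_nat n * s)) * pow_remainder n z N (1 / x) s"
        by (simp add: distrib_left sum_distrib_left mult_ac)
      also have "(\<lambda>m. x powr (- (of_nat n * s)) * (1 / x) ^ m) = (\<lambda>m. x powr (- (of_nat n * s + of_nat m)))"
      proof
        fix m :: nat
        have "x powr (- (of_nat n * s + of_nat m)) = x powr (- (of_nat n * s)) / x powr (of_nat m)"
          using powr_diff[of x "- (of_nat n * s)" "of_nat m"] by simp
        then show "x powr (- (of_nat n * s)) * (1 / x) ^ m = x powr (- (of_nat n * s + of_nat m))"
          using xp(2) by (simp add: powr_nat' power_divide)
      qed
      finally show ?thesis by (simp add: x_def)
    qed
    have "((\<lambda>k. f k s) has_sum ((\<Sum>m\<le>N. pow_coeff n z m s * zeta_tail 0 L (of_nat n * s + of_nat m)) + r s)) T"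
    proof (subst has_sum_cong[OF f_tail])
      show "((\<lambda>k. (\<Sum>m\<le>N. pow_coeff n z m s * (idot N k \<omega> + 0) powr (- (of_nat n * s + of_nat m))) +
        idot N k \<omega> powr (- (of_nat n * s)) * pow_remainder n z N (1 / idot N k \<omega>) s) has_sum
          ((\<Sum>m\<le>N. pow_coeff n z m s * zeta_tail 0 L (of_nat n * s + of_nat m)) + r s)) T"
        unfolding r_def zeta_tail_def T_def
        using ns s1
        by (intro has_sum_add has_sum_sum has_sum_cmult_right has_sum_infsum zeta_tail_summable[OF adm \<rho>1]
              pow_remainder_facts(1)) auto
    qed
    moreover have "((\<lambda>k. f k s) has_sum (\<Sum>k\<in>I - T. f k s)) (I - T)"
      using fin by (rule has_sum_finite)
    ultimately have "((\<lambda>k. f k s) has_sum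
        ((\<Sum>m\<le>N. pow_coeff n z m s * zeta_tail 0 L (of_nat n * s + of_nat m)) + r s) +
        (\<Sum>k\<in>I - T. f k s)) (T \<union> (I - T))"
      by (rule has_sum_Un_disjoint) auto
    moreover have "T \<union> (I - T) = I" using TI by auto
    moreover have "(\<Sum>m\<le>N. pow_coeff n z m s * zeta_tail 0 L (of_nat n * s + of_nat m)) =
        Y (of_nat n * s) / pole_poly (of_nat n * s) +
        (\<Sum>m=1..N. 1 / of_nat n * (pow_coeff' n z m s * polar_factor Y m (of_nat n * s)))"
    proof -
      have zt: "zeta_tail 0 L t = Y t / pole_poly t" if "Re t > real N" for t
        using Y(2)[OF that] pole_poly_nonzero[OF that] by (simp add: field_simps)
      have "pow_coeff n z m s * zeta_tail 0 L (of_nat n * s + of_nat m) =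
           1 / of_nat n * (pow_coeff' n z m s * polar_factor Y m (of_nat n * s))" if m: "m \<in> {1..N}" for m
      proof -
        have "zeta_tail 0 L (of_nat n * s + of_nat m) = Y (of_nat n * s + of_nat m) / pole_poly (of_nat n * s + of_nat m)"
          by (rule zt) (use ns in simp)
        also have "\<dots> = 1 / (of_nat n * s) * polar_factor Y m (of_nat n * s)"
          unfolding pole_poly_shift[OF m] polar_factor_def by (simp add: divide_simps)
        finally show ?thesis
          using m s0 n pow_coeff_eq[of m n z s] by (simp add: field_simps)
      qed
      then have "(\<Sum>m=1..N. pow_coeff n z m s * zeta_tail 0 L (of_nat n * s + of_nat m)) =
          (\<Sum>m=1..N. 1 / of_nat n * (pow_coeff' n z m s * polar_factor Y m (of_nat n * s)))"
        by (rule sum.cong[OF refl])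
      moreover have "(\<Sum>m\<le>N. pow_coeff n z m s * zeta_tail 0 L (of_nat n * s + of_nat m)) =
          zeta_tail 0 L (of_nat n * s) + (\<Sum>m=1..N. pow_coeff n z m s * zeta_tail 0 L (of_nat n * s + of_nat m))"
        unfolding atMost_atLeast0 by (subst sum.atLeast_Suc_atMost) (auto simp: pow_coeff_0)
      moreover have "zeta_tail 0 L (of_nat n * s) = Y (of_nat n * s) / pole_poly (of_nat n * s)"
        by (rule zt) (use ns in simp)
      ultimately show ?thesis by simp
    qed
    ultimately show ?thesis by (simp add: Z_def infsumI add_ac)
  qed
  then show ?thesis
    using mer Z_ana deriv by (intro exI[of _ Z]) (auto simp: f_def I_def)
qed

end

section \<open>The regularized product\<close>

text \<open>Half-planes are connected, so agreement far to the right spreads past the poles to a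
  punctured neighbourhood of 0; continuity then adds the point 0.\<close>

lemma deriv_eq_of_meromorphic_eq:
  fixes f g :: "complex \<Rightarrow> complex"
  assumes f: "f meromorphic_on {s. Re s > - \<epsilon>}" "f analytic_on {0}"
    and g: "g meromorphic_on {s. Re s > - \<epsilon>}" "g analytic_on {0}"
    and \<epsilon>: "\<epsilon> > 0" and eq: "\<And>s. Re s > b \<Longrightarrow> f s = g s"
  shows "deriv f 0 = deriv g 0"
proof (rule deriv_cong_ev[OF _ refl])
  define U where "U = {s. Re s > max b 0}"
  have "eventually (\<lambda>s. f s = g s) (at 0)"
  proof (rule meromorphic_on_eventually_eq[OF f(1) g(1), where U = U])
    show "open {s. - \<epsilon> < Re s}" by (rule open_halfspace_Re_gt)
    show "open U" unfolding U_def by (rule open_halfspace_Re_gt)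
    show "connected {s. - \<epsilon> < Re s}"
      by (intro convex_connected convex_halfspace_Re_gt)
    show "U \<noteq> {}" by (auto simp: U_def intro!: exI[of _ "of_real (max b 0 + 1)"])
  qed (use eq \<epsilon> in \<open>auto simp: U_def\<close>)
  moreover have "f 0 = g 0"
  proof (rule LIM_unique)
    show "g \<midarrow>0\<rightarrow> g 0" using g(2) by (intro isContD analytic_at_imp_isCont)
    have "f \<midarrow>0\<rightarrow> f 0" using f(2) by (intro isContD analytic_at_imp_isCont)
    then show "g \<midarrow>0\<rightarrow> f 0" using tendsto_cong[OF calculation] by blast
  qed
  ultimately show "eventually (\<lambda>s. f s = g s) (nhds 0)"
    by (auto simp: eventually_at_filter elim!: eventually_mono)
qed

text \<open>The given \<open>Z\<close> witnesses that the choice is meaningful, and the chosen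
  continuation has the same derivative at 0; the two widths may differ, so the smaller one is
  used.\<close>

lemma barnes_D_eqI:
  assumes Z: "Z meromorphic_on {s. Re s > - \<epsilon>}" "\<epsilon> > 0" "Z analytic_on {0}"
    and series: "\<And>s. Re s > real N / real n \<Longrightarrow>
       Z s = (\<Sum>\<^sub>\<infinity>k\<in>multi_indices N. \<Prod>j=1..n. (idot N k \<omega> - z j) powr (- s))"
  shows "barnes_D N n z \<omega> = exp (- deriv Z 0)"
proof -
  define P where "P Z \<longleftrightarrow> (\<exists>\<epsilon>>0. Z meromorphic_on {s. Re s > - \<epsilon>}) \<and> Z analytic_on {0} \<and>
        (\<forall>s. Re s > real N / real n \<longrightarrow>
           Z s = (\<Sum>\<^sub>\<infinity>k\<in>multi_indices N. \<Prod>j=1..n. (idot N k \<omega> - z j) powr (- s)))" for Z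
  have "P Z" unfolding P_def using Z series by blast
  then have P: "P (SOME Z. P Z)" by (rule someI[of P])
  then obtain \<delta> where \<delta>: "\<delta> > 0" "(SOME Z. P Z) meromorphic_on {s. Re s > - \<delta>}"
    unfolding P_def by blast
  have "deriv (SOME Z. P Z) 0 = deriv Z 0"
  proof (rule deriv_eq_of_meromorphic_eq[where \<epsilon> = "min \<delta> \<epsilon>" and b = "real N / real n"])
    show "(SOME Z. P Z) meromorphic_on {s. - min \<delta> \<epsilon> < Re s}"
      using \<delta>(2) by (rule meromorphic_on_subset) auto
    show "Z meromorphic_on {s. - min \<delta> \<epsilon> < Re s}"
      using Z(1) by (rule meromorphic_on_subset) auto
    show "(SOME Z. P Z) analytic_on {0}" using P unfolding P_def by blast
    show "(SOME Z. P Z) s = Z s" if "Re s > real N / real n" for s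
      using P series[OF that] that unfolding P_def by simp
  qed (use \<delta> Z in auto)
  then show ?thesis by (simp add: barnes_D_def P_def)
qed

section \<open>Quadratic coefficients of the logarithms\<close>

lemma sum_square_pairs:
  fixes a :: "nat \<Rightarrow> 'a :: comm_ring_1"
  shows "(\<Sum>j=1..n. a j) ^ 2 = (\<Sum>j=1..n. a j ^ 2) +
    2 * (\<Sum>(j1, j2)\<in>{(j1, j2). 1 \<le> j1 \<and> j1 < j2 \<and> j2 \<le> n}. a j1 * a j2)"
proof (induction n)
  case 0
  have empty: "{(j1, j2). 1 \<le> j1 \<and> j1 < j2 \<and> j2 \<le> (0::nat)} = {}" by auto
  show ?case unfolding empty by simp
next
  case (Suc n)
  let ?P = "\<lambda>n. {(j1, j2). 1 \<le> j1 \<and> j1 < j2 \<and> j2 \<le> (n::nat)}"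
  have fin: "finite (?P n)"
    by (rule finite_subset[of _ "{..n} \<times> {..n}"]) auto
  have "?P (Suc n) = ?P n \<union> (\<lambda>j. (j, Suc n)) ` {1..n}"
    by (auto simp: le_Suc_eq)
  moreover have "?P n \<inter> (\<lambda>j. (j, Suc n)) ` {1..n} = {}" by auto
  ultimately have "(\<Sum>(j1, j2)\<in>?P (Suc n). a j1 * a j2) =
      (\<Sum>(j1, j2)\<in>?P n. a j1 * a j2) + (\<Sum>(j1, j2)\<in>(\<lambda>j. (j, Suc n)) ` {1..n}. a j1 * a j2)"
    using fin by (simp add: sum.union_disjoint)
  also have "(\<Sum>(j1, j2)\<in>(\<lambda>j. (j, Suc n)) ` {1..n}. a j1 * a j2) = (\<Sum>j=1..n. a j) * a (Suc n)"
    by (subst sum.reindex) (auto simp: inj_on_def sum_distrib_right)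
  finally show ?case using Suc by (simp add: power2_sum distrib_left)
qed

lemma log_fps_mult_nth:
  "fps_nth (log_fps a * log_fps b) l = (\<Sum>r=1..l-1. a ^ r * b ^ (l - r) / (of_nat r * of_nat (l - r)))"
proof -
  have "fps_nth (log_fps a * log_fps b) l = (\<Sum>r=0..l. a ^ r * b ^ (l - r) / (of_nat r * of_nat (l - r)))"
    by (simp add: fps_mult_nth log_fps_nth)
  \<comment> \<open>The end terms r = 0 and r = l have a zero denominator and so are 0, in
    accordance with the missing constant term of the logarithm.\<close>
  also have "\<dots> = (\<Sum>r=1..l-1. a ^ r * b ^ (l - r) / (of_nat r * of_nat (l - r)))"
    by (rule sum.mono_neutral_right) (auto simp: not_le)
  finally show ?thesis .
qed

text \<open>Partial fractions 1 / (r (l - r)) = (1 / r + 1 / (l - r)) / l turn the convolution into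
  twice a harmonic sum: the origin of H_(l-1).\<close>

lemma log_fps_square_nth:
  "fps_nth (log_fps z ^ 2) l = 2 * z ^ l * harm (l - 1) / of_nat l"
proof -
  have "fps_nth (log_fps z ^ 2) l = (\<Sum>r=1..l-1. z ^ l / of_nat l * (inverse (of_nat r) + inverse (of_nat (l - r))))"
    unfolding power2_eq_square log_fps_mult_nth
  proof (intro sum.cong refl)
    fix r assume r: "r \<in> {1..l-1}"
    then have l: "r + (l - r) = l" by auto
    have "z ^ r * z ^ (l - r) = z ^ l" unfolding power_add[symmetric] l ..
    moreover have "of_nat l = (of_nat r + of_nat (l - r) :: complex)"
      unfolding of_nat_add[symmetric] l ..
    moreover have "(of_nat r :: complex) \<noteq> 0" "(of_nat (l - r) :: complex) \<noteq> 0"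
        "(of_nat l :: complex) \<noteq> 0"
      using r by auto
    moreover have "x / (a * b) = x / c * (inverse a + inverse b)"
      if "c = a + b" "a \<noteq> 0" "b \<noteq> 0" "c \<noteq> 0" for a b c x :: complex
    proof -
      have "inverse a + inverse b = c * inverse a * inverse b"
        using that inverse_add[of a b] by simp
      then show ?thesis using that(4) by (simp add: divide_inverse)
    qed
    ultimately show "z ^ r * z ^ (l - r) / (of_nat r * of_nat (l - r)) =
        z ^ l / of_nat l * (inverse (of_nat r) + inverse (of_nat (l - r)))"
      by metis
  qed
  also have "\<dots> = z ^ l / of_nat l * ((\<Sum>r=1..l-1. inverse (of_nat r)) + (\<Sum>r=1..l-1. inverse (of_nat (l - r))))"
    by (simp add: sum_distrib_left sum.distrib distrib_left)
  also have "(\<Sum>r=1..l-1. inverse (of_nat (l - r))) = (\<Sum>r=1..l-1. inverse (of_nat r) :: complex)"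
    by (rule sum.reindex_bij_witness[of _ "\<lambda>r. l - r" "\<lambda>r. l - r"]) auto
  finally show ?thesis by (simp add: harm_def)
qed

lemma prod_diff_punctured:
  assumes "m \<in> {1..N}"
  shows "(\<Prod>i\<in>{1..N} - {m}. of_nat i - of_nat m) = ((-1) ^ (m - 1) * fact (m - 1) * fact (N - m) :: complex)"
proof -
  have "{1..N} - {m} = {1..m-1} \<union> {m+1..N}" using assms by auto
  then have "(\<Prod>i\<in>{1..N} - {m}. of_nat i - of_nat m) =
      (\<Prod>i=1..m-1. of_nat i - of_nat m) * (\<Prod>i=m+1..N. of_nat i - of_nat m :: complex)"
    by (simp only:) (rule prod.union_disjoint, auto)
  also have "(\<Prod>i=1..m-1. of_nat i - of_nat m) = (\<Prod>d=1..m-1. - of_nat d :: complex)"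
    by (rule prod.reindex_bij_witness[of _ "\<lambda>d. m - d" "\<lambda>d. m - d"]) (auto simp: of_nat_diff)
  also have "\<dots> = (-1) ^ (m - 1) * fact (m - 1)"
    by (simp add: prod_uminus fact_prod)
  also have "(\<Prod>i=m+1..N. of_nat i - of_nat m) = (\<Prod>d=1..N-m. of_nat d :: complex)"
    by (rule prod.reindex_bij_witness[of _ "\<lambda>d. m + d" "\<lambda>i. i - m"]) (auto simp: of_nat_diff)
  also have "\<dots> = fact (N - m)" by (simp add: fact_prod)
  finally show ?thesis .
qed

section \<open>The Barnes gamma function and the residues at w = 0\<close>

context barnes_lattice
begin

text \<open>The definite description denotes once a continuation to the whole plane exists; the tail
  continuation for this w provides it. After that, any continuation to a half-plane around 0
  computes the derivative, in particular one expanded around w = 0.\<close>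

lemma barnes_Gamma_eqI:
  assumes w: "\<And>k. k \<in> multi_indices N \<Longrightarrow> idot N k \<omega> + w \<noteq> 0"
    and Z: "Z meromorphic_on {s. Re s > - \<epsilon>}" "\<epsilon> > 0" "Z analytic_on {0}"
    and series: "\<And>s. Re s > real N \<Longrightarrow>
       Z s = (\<Sum>\<^sub>\<infinity>k\<in>multi_indices N. (idot N k \<omega> + w) powr (- s))"
  shows "barnes_Gamma N w \<omega> = exp (deriv Z 0)"
proof -
  obtain L where adm: "admissible w L (4 * omega_bound)"
    using eventually_admissible eventually_happens trivial_limit_sequentially by blast
  have \<rho>1: "4 * omega_bound \<ge> 1" using omega_bound_ge_1 by linarith
  obtain Y where Y: "Y holomorphic_on UNIV" "\<And>s. Re s > real N \<Longrightarrow> pole_poly s * zeta_tail w L s = Y s"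
    using zeta_tail_continuation[OF adm] by metis
  define I where "I = multi_indices N"
  define T where "T = index_tail N L"
  have TI: "T \<subseteq> I" by (simp add: T_def I_def index_tail_subset)
  have fin: "finite (I - T)" by (simp add: T_def I_def finite_index_complement)
  define F where "F s = (\<Sum>k\<in>I - T. (idot N k \<omega> + w) powr (- s)) + Y s / pole_poly s" for s
  have Fs: "F s = (\<Sum>\<^sub>\<infinity>k\<in>multi_indices N. (idot N k \<omega> + w) powr (- s))" if s: "Re s > real N" for s
  proof -
    have "((\<lambda>k. (idot N k \<omega> + w) powr (- s)) has_sum
        (zeta_tail w L s + (\<Sum>k\<in>I - T. (idot N k \<omega> + w) powr (- s)))) (T \<union> (I - T))"
    proof (rule has_sum_Un_disjoint)
      show "((\<lambda>k. (idot N k \<omega> + w) powr (- s)) has_sum zeta_tail w L s) T"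
        unfolding zeta_tail_def T_def by (intro has_sum_infsum zeta_tail_summable[OF adm \<rho>1 s])
    qed (use fin in \<open>auto intro: has_sum_finite\<close>)
    moreover have "T \<union> (I - T) = I" using TI by auto
    moreover have "zeta_tail w L s = Y s / pole_poly s"
      using Y(2)[OF s] pole_poly_nonzero[OF s] by (simp add: field_simps)
    ultimately show ?thesis by (simp add: F_def I_def infsumI add_ac)
  qed
  have fin_holo: "(\<lambda>s. \<Sum>k\<in>I - T. (idot N k \<omega> + w) powr (- s)) holomorphic_on UNIV"
    unfolding powr_def using w by (auto simp: I_def intro!: holomorphic_intros)
  have ana: "g analytic_on X" if "g holomorphic_on UNIV" for g :: "complex \<Rightarrow> complex" and X
    using that by (meson analytic_on_open analytic_on_subset open_UNIV subset_UNIV)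
  have F_ana: "F analytic_on {s}" if "pole_poly s \<noteq> 0" for s
    unfolding F_def[abs_def] using that
    by (intro analytic_on_add analytic_on_divide ana fin_holo Y(1) holomorphic_intros) auto
  have F_mer: "F meromorphic_on X" for X
    unfolding F_def[abs_def]
    by (intro meromorphic_on_add meromorphic_on_divide analytic_on_imp_meromorphic_on ana fin_holo
          Y(1) holomorphic_intros)
  \<comment> \<open>\<open>remove_sings\<close> gives 0 at poles and limits at removable
    singularities, such as zeros of \<open>pole_poly\<close> where Y vanishes too.\<close>
  define G where "G = remove_sings F"
  have G: "G nicely_meromorphic_on UNIV"
    unfolding G_def by (rule remove_sings_nicely_meromorphic[OF F_mer])
  have Gs: "G s = (\<Sum>\<^sub>\<infinity>k\<in>multi_indices N. (idot N k \<omega> + w) powr (- s))" if "Re s > real N" for s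
    unfolding G_def using F_ana[OF pole_poly_nonzero[OF that]] Fs[OF that] by simp
  have "(THE G. G nicely_meromorphic_on UNIV \<and>
        (\<forall>s. Re s > real N \<longrightarrow>
           G s = (\<Sum>\<^sub>\<infinity>k\<in>multi_indices N. (idot N k \<omega> + w) powr (- s)))) = G"
  proof (rule the_equality)
    fix H assume H: "H nicely_meromorphic_on UNIV \<and>
        (\<forall>s. Re s > real N \<longrightarrow>
           H s = (\<Sum>\<^sub>\<infinity>k\<in>multi_indices N. (idot N k \<omega> + w) powr (- s)))"
    show "H = G"
    proof (rule nicely_meromorphic_on_eqI)
      show "open {s. Re s > real N}" by (rule open_halfspace_Re_gt)
      show "{s. Re s > real N} \<noteq> {}" by (auto intro!: exI[of _ "of_real (real N + 1)"])
    qed (use H G Gs in auto)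
  qed (use G Gs in auto)
  then have "barnes_Gamma N w \<omega> = exp (deriv G 0)"
    by (simp add: barnes_Gamma_def barnes_zeta_def)
  also have "deriv G 0 = deriv F 0"
    unfolding G_def using F_ana[OF pole_poly_0] by simp
  also have "deriv F 0 = deriv Z 0"
    by (rule deriv_eq_of_meromorphic_eq[OF F_mer F_ana[OF pole_poly_0] Z(1,3,2), of "real N"])
       (use Fs series in auto)
  finally show ?thesis .
qed

lemma polar_factor_at_0:
  assumes m: "m \<in> {1..N}" and Y: "Y (of_nat m) = (-1) ^ N * B (N - m)"
  shows "polar_factor Y m 0 = (-1) ^ (N - m) * B (N - m) / (fact (m - 1) * fact (N - m))"
proof -
  have "polar_factor Y m 0 = - ((-1) ^ N * B (N - m)) / ((-1) ^ (m - 1) * fact (m - 1) * fact (N - m))"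
    using prod_diff_punctured[OF m] by (simp add: polar_factor_def Y)
  \<comment> \<open>From N = (N - m) + (m - 1) + 1; the last sign cancels the leading minus of
    \<open>polar_factor\<close>.\<close>
  moreover have "(-1) ^ N = (-1) ^ (N - m) * (-1) ^ (m - 1) * (-1 :: complex)"
  proof -
    have "N = Suc ((N - m) + (m - 1))" using m by auto
    then have "(-1 :: complex) ^ N = (-1) ^ Suc ((N - m) + (m - 1))" by simp
    then show ?thesis by (simp add: power_add)
  qed
  ultimately show ?thesis by (simp add: field_simps)
qed

lemma residue_sum_square:
  assumes "\<And>m. m \<in> {1..N} \<Longrightarrow> Y (of_nat m) = (-1) ^ N * B (N - m)"
  shows "(\<Sum>l=1..N. polar_factor Y l 0 * fps_nth (log_fps z ^ 2) l / 2) =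
     (\<Sum>l=2..N. (-1) ^ (N - l) * harm (l - 1) / (fact l * fact (N - l)) * B (N - l) * z ^ l)"
proof -
  have "(\<Sum>l=1..N. polar_factor Y l 0 * fps_nth (log_fps z ^ 2) l / 2) =
        (\<Sum>l=1..N. (-1) ^ (N - l) * harm (l - 1) / (fact l * fact (N - l)) * B (N - l) * z ^ l)"
  proof (intro sum.cong refl)
    fix l assume l: "l \<in> {1..N}"
    then have "(fact l :: complex) = of_nat l * fact (l - 1)" by (simp add: fact_reduce)
    moreover have "polar_factor Y l 0 = (-1) ^ (N - l) * B (N - l) / (fact (l - 1) * fact (N - l))"
      by (rule polar_factor_at_0) (use l assms in auto)
    ultimately show "polar_factor Y l 0 * fps_nth (log_fps z ^ 2) l / 2 =
        (-1) ^ (N - l) * harm (l - 1) / (fact l * fact (N - l)) * B (N - l) * z ^ l"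
      by (simp add: log_fps_square_nth mult_ac)
  qed
  \<comment> \<open>The term l = 1 is 0 because \<open>harm 0\<close> is an empty sum.\<close>
  also have "\<dots> = (\<Sum>l=2..N. (-1) ^ (N - l) * harm (l - 1) / (fact l * fact (N - l)) * B (N - l) * z ^ l)"
    by (rule sum.mono_neutral_right) (auto simp: not_le numeral_2_eq_2 less_Suc_eq harm_def)
  finally show ?thesis .
qed

lemma residue_sum_mult:
  assumes "\<And>m. m \<in> {1..N} \<Longrightarrow> Y (of_nat m) = (-1) ^ N * B (N - m)"
  shows "(\<Sum>l=1..N. polar_factor Y l 0 * fps_nth (log_fps a * log_fps b) l) =
     (\<Sum>l=2..N. \<Sum>r=1..l-1. (-1) ^ (N - l) * B (N - l) * a ^ r * b ^ (l - r)
                / (of_nat r * of_nat (l - r) * fact (l - 1) * fact (N - l)))"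
proof -
  have "(\<Sum>l=1..N. polar_factor Y l 0 * fps_nth (log_fps a * log_fps b) l) =
     (\<Sum>l=1..N. \<Sum>r=1..l-1. (-1) ^ (N - l) * B (N - l) * a ^ r * b ^ (l - r)
                / (of_nat r * of_nat (l - r) * fact (l - 1) * fact (N - l)))"
    unfolding log_fps_mult_nth sum_distrib_left
    by (intro sum.cong refl) (simp add: polar_factor_at_0 assms mult_ac)
  also have "\<dots> = (\<Sum>l=2..N. \<Sum>r=1..l-1. (-1) ^ (N - l) * B (N - l) * a ^ r * b ^ (l - r)
                / (of_nat r * of_nat (l - r) * fact (l - 1) * fact (N - l)))"
    by (rule sum.mono_neutral_right) (auto simp: not_le numeral_2_eq_2 less_Suc_eq)
  finally show ?thesis .
qed

end

section \<open>Comparison of the product with its single factors\<close>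

theorem corollary3p3:
  fixes N n :: nat and \<omega> z :: "nat \<Rightarrow> complex"
  assumes "N \<ge> 1" and "n \<ge> 1"
    and "\<And>i. i \<in> {1..N} \<Longrightarrow> Re (\<omega> i) > 0"
    and "\<And>j k. j \<in> {1..n} \<Longrightarrow> k \<in> multi_indices N \<Longrightarrow> z j \<noteq> idot N k \<omega>"
  shows "barnes_D N n z \<omega> * (\<Prod>j=1..n. barnes_Gamma N (- z j) \<omega>) =
    exp ((1 - 1 / of_nat n) *
           (\<Sum>j=1..n. \<Sum>l=2..N.
              (-1) ^ (N - l) * harm (l - 1) / (fact l * fact (N - l))
                * multi_bernoulli N (N - l) 0 \<omega> * z j ^ l)
         - 1 / of_nat n *
           (\<Sum>(j1, j2)\<in>{(j1, j2). 1 \<le> j1 \<and> j1 < j2 \<and> j2 \<le> n}. \<Sum>l=2..N. \<Sum>r=1..l-1.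
              (-1) ^ (N - l) * multi_bernoulli N (N - l) 0 \<omega> * z j1 ^ r * z j2 ^ (l - r)
                / (of_nat r * of_nat (l - r) * fact (l - 1) * fact (N - l))))"
proof -
  interpret barnes_lattice N \<omega> using assms(1,3) by unfold_locales auto
  \<comment> \<open>One bound for all expansions: \<open>4 * omega_bound\<close> serves the
    antidifference, the other summands serve the logarithms.\<close>
  define \<rho> where "\<rho> = 4 * omega_bound + (\<Sum>j=1..n. 4 * (1 + norm (z j)))"
  have nonneg: "0 \<le> (\<Sum>j=1..n. 4 * (1 + norm (z j)))" by (intro sum_nonneg) auto
  then have \<rho>: "\<rho> \<ge> 4 * omega_bound" by (simp add: \<rho>_def)
  have z\<rho>: "4 * (1 + norm (z j)) \<le> \<rho>" if "j \<in> {1..n}" for j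
  proof -
    have "4 * (1 + norm (z j)) \<le> (\<Sum>j=1..n. 4 * (1 + norm (z j)))"
      by (rule member_le_sum) (use that in auto)
    then show ?thesis using omega_bound_ge_1 by (simp add: \<rho>_def)
  qed
  obtain L where adm: "admissible 0 L \<rho>"
    using eventually_admissible eventually_happens trivial_limit_sequentially by blast
  obtain Y where Y: "Y holomorphic_on UNIV" "\<And>s. Re s > real N \<Longrightarrow> pole_poly s * zeta_tail 0 L s = Y s"
    and Ym: "\<And>m. m \<in> {1..N} \<Longrightarrow> Y (of_nat m) = (-1) ^ N * B (N - m)"
    by (rule zeta_tail_continuation[OF admissible_mono[OF adm \<rho>]]) (rule that, auto)
  let ?P = "{(j1, j2). 1 \<le> j1 \<and> j1 < j2 \<and> j2 \<le> n}"
  define S where "S j = (\<Sum>l=2..N. (-1) ^ (N - l) * harm (l - 1) / (fact l * fact (N - l)) *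
      B (N - l) * z j ^ l)" for j
  define R where "R j1 j2 = (\<Sum>l=2..N. \<Sum>r=1..l-1. (-1) ^ (N - l) * B (N - l) * z j1 ^ r * z j2 ^ (l - r)
                / (of_nat r * of_nat (l - r) * fact (l - 1) * fact (N - l)))" for j1 j2

  \<comment> \<open>For n = 1 and a constant family the product series is the Barnes zeta series at
    w = - z j; the square of the single logarithm yields \<open>S j\<close>.\<close>
  have Gamma: "barnes_Gamma N (- z j) \<omega> = exp (log_part L Y (z j) + S j)" if j: "j \<in> {1..n}" for j
  proof -
    have "\<exists>Z. Z meromorphic_on {s. Re s > - 1 / real 1} \<and> Z analytic_on {0} \<and>
      (\<forall>s. Re s > real N / real 1 \<longrightarrow>
         Z s = (\<Sum>\<^sub>\<infinity>k\<in>multi_indices N. \<Prod>j'\<in>{1..1::nat}. (idot N k \<omega> - z j) powr (- s))) \<and>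
      deriv Z 0 = (\<Sum>j'\<in>{1..1::nat}. log_part L Y (z j)) +
         1 / of_nat 1 * (\<Sum>m=1..N. polar_factor Y m 0 * fps_nth (log_fps_sum 1 (\<lambda>_. z j) ^ 2) m / 2)"
    proof (rule regularized_continuation[where n = 1 and z = "\<lambda>_. z j" and \<rho> = \<rho> and L = L and Y = Y])
      show "4 * (1 + norm (z j)) \<le> \<rho>" by (rule z\<rho>[OF j])
      show "z j \<noteq> idot N k \<omega>" if "k \<in> multi_indices N" for k by (rule assms(4)[OF j that])
    qed (use adm \<rho> Y in auto)
    then obtain Z where Z: "Z meromorphic_on {s. Re s > - 1 / real 1}" "Z analytic_on {0}"
      "\<forall>s. Re s > real N / real 1 \<longrightarrow>
         Z s = (\<Sum>\<^sub>\<infinity>k\<in>multi_indices N. \<Prod>j'\<in>{1..1::nat}. (idot N k \<omega> - z j) powr (- s))"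
      "deriv Z 0 = (\<Sum>j'\<in>{1..1::nat}. log_part L Y (z j)) +
         1 / of_nat 1 * (\<Sum>m=1..N. polar_factor Y m 0 * fps_nth (log_fps_sum 1 (\<lambda>_. z j) ^ 2) m / 2)"
      by (elim exE conjE) (rule that)
    have dZ: "deriv Z 0 = log_part L Y (z j) + (\<Sum>m=1..N. polar_factor Y m 0 * fps_nth (log_fps (z j) ^ 2) m / 2)"
      using Z(4) by (simp add: log_fps_sum_def)
    have "barnes_Gamma N (- z j) \<omega> = exp (deriv Z 0)"
    proof (rule barnes_Gamma_eqI)
      show "idot N k \<omega> + - z j \<noteq> 0" if "k \<in> multi_indices N" for k
        using assms(4)[OF j that] by auto
      show "Z meromorphic_on {s. - 1 < Re s}" using Z(1) by simp
    qed (use Z(2,3) in auto)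
    then show ?thesis
      by (simp only: dZ residue_sum_square[of Y, OF Ym] S_def)
  qed

  obtain Z where Z: "Z meromorphic_on {s. Re s > - 1 / real n}" "Z analytic_on {0}"
    "\<forall>s. Re s > real N / real n \<longrightarrow>
       Z s = (\<Sum>\<^sub>\<infinity>k\<in>multi_indices N. \<Prod>j=1..n. (idot N k \<omega> - z j) powr (- s))"
    "deriv Z 0 = (\<Sum>j=1..n. log_part L Y (z j)) +
      1 / of_nat n * (\<Sum>m=1..N. polar_factor Y m 0 * fps_nth (log_fps_sum n z ^ 2) m / 2)"
    using regularized_continuation[where z = z and Y = Y, OF adm \<rho> assms(2) z\<rho> assms(4) Y]
    by blast
  have D: "barnes_D N n z \<omega> = exp (- deriv Z 0)"
    by (rule barnes_D_eqI[where \<epsilon> = "1 / real n"]) (use Z assms(2) in auto)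

  \<comment> \<open>The diagonal of the square reproduces the terms \<open>S j\<close> of the single
    factors. In the mixed products the 2 cancels the 1/2 of the second-order coefficient, which
    gives \<open>R\<close>.\<close>
  have "fps_nth (log_fps_sum n z ^ 2) m = (\<Sum>j=1..n. fps_nth (log_fps (z j) ^ 2) m) +
      2 * (\<Sum>(j1, j2)\<in>?P. fps_nth (log_fps (z j1) * log_fps (z j2)) m)" for m
  proof -
    have two: "fps_nth (2 * f) m = 2 * fps_nth f m" for f :: "complex fps"
      by (simp add: fps_numeral_fps_const)
    show ?thesis
      unfolding log_fps_sum_def sum_square_pairs by (simp add: two fps_sum_nth split_def)
  qed
  then have "(\<Sum>m=1..N. polar_factor Y m 0 * fps_nth (log_fps_sum n z ^ 2) m / 2) =
     (\<Sum>m=1..N. (\<Sum>j=1..n. polar_factor Y m 0 * fps_nth (log_fps (z j) ^ 2) m / 2) +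
        (\<Sum>p\<in>?P. polar_factor Y m 0 * fps_nth (log_fps (z (fst p)) * log_fps (z (snd p))) m))"
    by (simp add: split_def distrib_left add_divide_distrib sum_distrib_left sum_divide_distrib)
  also have "\<dots> = (\<Sum>j=1..n. \<Sum>m=1..N. polar_factor Y m 0 * fps_nth (log_fps (z j) ^ 2) m / 2) +
        (\<Sum>p\<in>?P. \<Sum>m=1..N. polar_factor Y m 0 * fps_nth (log_fps (z (fst p)) * log_fps (z (snd p))) m)"
    unfolding sum.distrib by (intro arg_cong2[where f = "(+)"] sum.swap)
  also have "\<dots> = (\<Sum>j=1..n. S j) + (\<Sum>p\<in>?P. R (fst p) (snd p))"
    by (simp only: residue_sum_square[of Y, OF Ym] residue_sum_mult[of Y, OF Ym] S_def R_def)
  finally have dZ: "deriv Z 0 = (\<Sum>j=1..n. log_part L Y (z j)) +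
      1 / of_nat n * ((\<Sum>j=1..n. S j) + (\<Sum>p\<in>?P. R (fst p) (snd p)))"
    using Z(4) by simp

  have "(\<Prod>j=1..n. barnes_Gamma N (- z j) \<omega>) = exp (\<Sum>j=1..n. log_part L Y (z j) + S j)"
    by (simp add: Gamma exp_sum)
  then have "barnes_D N n z \<omega> * (\<Prod>j=1..n. barnes_Gamma N (- z j) \<omega>) =
      exp (- deriv Z 0 + (\<Sum>j=1..n. log_part L Y (z j) + S j))"
    by (simp only: D exp_add)
  \<comment> \<open>The \<open>log_part\<close> values cancel; \<open>S j\<close> has coefficient 1
    from its gamma factor and -1 / n from the regularized product.\<close>
  also have "- deriv Z 0 + (\<Sum>j=1..n. log_part L Y (z j) + S j) =
      (1 - 1 / of_nat n) * (\<Sum>j=1..n. S j) - 1 / of_nat n * (\<Sum>(j1, j2)\<in>?P. R j1 j2)"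
    by (simp add: dZ sum.distrib split_def algebra_simps)
  finally show ?thesis unfolding S_def R_def .
qed

end
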